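(* Let $(\hat K,i,j,\delta,ch)$ be a differential K-functor and $M$ a compact smooth manifold with corners. There is a unique topology on the differential K-group $\hat K(M)$ compatible with its group structure such that the sequence $$0\to\Omega^{od}(M)/\Omega_U(M)\xrightarrow{i}\hat K(M)\xrightarrow{\delta}K(M)\to0$$ is strictly exact. Moreover, with this topology $\Omega^{od}/\Omega_U$ (that is, its image under $i$) is the identity component of $\hat K(M)$.
   Context: Groups. For a compact smooth manifold with corners $M$ let $\Omega^{k}(M)$ be the real-valued smooth $k$-forms, $\Omega^{ev}$, $\Omega^{od}$ the total even/odd forms, $d$ the exterior derivative, $H^{ev}(M;\mathbf R)$, $H^{od}(M;\mathbf R)$ the total even/odd real cohomology (identified with de Rham cohomology). A smooth SAC cycle in $M$ is a pair $(V,f)$ with $V$ a closed stably almost complex manifold and $f:V\to M$ smooth; the period of a closed form $\omega$ over it is $\int_V f^*\omega\cdot Td(V)$, where the Todd class is represented by a closed form via Chern-Weil theory for a unitary connection on the stable tangent bundle. $\Omega_{BU}(M)$ (resp. $\Omega_U(M)$) is the group of closed even (resp. odd) forms having integer periods over all even (resp. odd) dimensional smooth SAC cycles; both contain the exact forms. $K=K^0$ is complex topological K-theory, $K^{-1}_A$ degree $-1$ complex K-theory with coefficients in $A$. Natural maps. $c:K\to H^{ev}(\mathbf R)$ is the Chern character; $\beta:K^{-1}_{\mathbf R/\mathbf Z}\to K$ is the Bockstein; $\mathrm{mod}\ \mathbf Z:H^{od}(\mathbf R)\cong K^{-1}_{\mathbf R}\to K^{-1}_{\mathbf R/\mathbf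 Z}$ is the coefficient map (identification via Chern character); $\mathrm{deR}:\Omega_{BU}\to H^{ev}(\mathbf R)$ takes de Rham classes, $\mathrm{deR}:H^{od}(\mathbf R)\to\Omega^{od}/\Omega_U$ sends a class to the class of a closed representative; $d:\Omega^{od}/\Omega_U\to\Omega_{BU}$ is induced by $d$. A differential K-functor is a 5-tuple $(\hat K,i,j,\delta,ch)$ where $\hat K$ is a contravariant functor from compact manifolds with corners (with smooth maps) to abelian groups, and $i:\Omega^{od}/\Omega_U\to\hat K$, $j:K^{-1}_{\mathbf R/\mathbf Z}\to\hat K$, $\delta:\hat K\to K$, $ch:\hat K\to\Omega_{BU}$ are natural transformations such that $0\to\Omega^{od}/\Omega_U\xrightarrow{i}\hat K\xrightarrow{\delta}K\to0$ and $0\to K^{-1}_{\mathbf R/\mathbf Z}\xrightarrow{j}\hat K\xrightarrow{ch}\Omega_{BU}\to0$ are exact and $i\circ\mathrm{deR}=j\circ(\mathrm{mod}\ \mathbf Z)$, $\delta\circ j=\beta$, $ch\circ i=d$, $\mathrm{deR}\circ ch=c\circ\delta$. Topologies. A continuous homomorphism of topological groups is strict if it is open onto its image; a sequence is strictly exact if it is exact and all its homomorphisms are continuous and strict. $\Omega^k(M)$ carries the Fréchet topology of the seminorms $\|\omega\|_n=\sum_{j=0}^n\sup|D^j\omega|$ ($D^j$ = $j$-th covariant derivative, for any Riemannian metric and connection); $\Omega_U$ has the subspace topology and $\Omega^{od}/\Omega_U$ the quotient topology; $K(M)$ is discrete. *)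

theory Defs
  imports
    "HOL-Analysis.Analysis"
    "HOL-Algebra.Coset"
    "HOL-Combinatorics.Permutations"
    "HOL-Computational_Algebra.Formal_Power_Series"
    "Jordan_Normal_Form.Schur_Decomposition"
begin

hide_const (open) Finite_Cartesian_Product.mat Determinants.det Finite_Cartesian_Product.vec

section \<open>Compact manifolds with corners\<close>

text \<open>
  Points of \<open>\<real>\<^sup>n\<close> are sequences vanishing from index \<open>n\<close> on, topologised by the library's
  \<open>Euclidean_space n\<close>. The local model of an \<open>n\<close>-manifold with corners is the quadrant
  \<open>[0, \<infinity>)\<^sup>n\<close>.
\<close>

definition corner_space :: "nat \<Rightarrow> (nat \<Rightarrow> real) topology" where
  "corner_space n = subtopology (Euclidean_space n) {x. \<forall>i<n. 0 \<le> x i}"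

primrec Ck_on :: "nat \<Rightarrow> nat \<Rightarrow> (nat \<Rightarrow> real) set \<Rightarrow> ((nat \<Rightarrow> real) \<Rightarrow> 'a::real_normed_vector) \<Rightarrow> bool" where
  "Ck_on 0 n U F \<longleftrightarrow> continuous_on U F"
| "Ck_on (Suc k) n U F \<longleftrightarrow> continuous_on U F \<and>
     (\<forall>i<n. \<exists>G. (\<forall>x\<in>U. ((\<lambda>t. F (x(i := t))) has_vector_derivative G x) (at (x i))) \<and> Ck_on k n U G)"

text \<open>On a relatively open subset of a quadrant, smooth means: locally the restriction of a smooth
  function on an open subset of \<open>\<real>\<^sup>n\<close>.\<close>

definition smooth_on :: "nat \<Rightarrow> (nat \<Rightarrow> real) set \<Rightarrow> ((nat \<Rightarrow> real) \<Rightarrow> 'a::real_normed_vector) \<Rightarrow> bool" where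
  "smooth_on n W f \<longleftrightarrow>
     (\<forall>x\<in>W. \<exists>U F. openin (Euclidean_space n) U \<and> x \<in> U \<and> (\<forall>k. Ck_on k n U F) \<and> (\<forall>y\<in>U \<inter> W. F y = f y))"

type_synonym 'p chart = "'p set \<times> ('p \<Rightarrow> nat \<Rightarrow> real)"

record 'p mfd =
  pts :: "'p set"
  mdim :: nat
  atlas :: "'p chart set"

abbreviation cinv :: "'p chart \<Rightarrow> (nat \<Rightarrow> real) \<Rightarrow> 'p" where
  "cinv c \<equiv> inv_into (fst c) (snd c)"

definition mfd_top :: "'p mfd \<Rightarrow> 'p topology" where
  "mfd_top M = topology (\<lambda>W. W \<subseteq> pts M \<and>
     (\<forall>c\<in>atlas M. openin (corner_space (mdim M)) (snd c ` (W \<inter> fst c))))"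

definition compact_mfd :: "'p mfd \<Rightarrow> bool" where
  "compact_mfd M \<longleftrightarrow>
     (\<Union>c\<in>atlas M. fst c) = pts M \<and>
     (\<forall>c\<in>atlas M. inj_on (snd c) (fst c) \<and> openin (corner_space (mdim M)) (snd c ` fst c)) \<and>
     (\<forall>c\<in>atlas M. \<forall>c'\<in>atlas M.
        openin (corner_space (mdim M)) (snd c ` (fst c \<inter> fst c')) \<and>
        (\<forall>j<mdim M. smooth_on (mdim M) (snd c ` (fst c \<inter> fst c')) (\<lambda>x. snd c' (cinv c x) j))) \<and>
     Hausdorff_space (mfd_top M) \<and> compact_space (mfd_top M)"

definition closed_mfd :: "'p mfd \<Rightarrow> bool" where
  "closed_mfd M \<longleftrightarrow> compact_mfd M \<and> (\<forall>c\<in>atlas M. \<forall>p\<in>fst c. \<forall>i<mdim M. 0 < snd c p i)"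

definition smooth_fun :: "'p mfd \<Rightarrow> 'p set \<Rightarrow> ('p \<Rightarrow> 'a::real_normed_vector) \<Rightarrow> bool" where
  "smooth_fun M W h \<longleftrightarrow> (\<forall>c\<in>atlas M. smooth_on (mdim M) (snd c ` (W \<inter> fst c)) (\<lambda>x. h (cinv c x)))"

text \<open>Smooth maps are taken extensional, so that a map is determined by its values on the source.\<close>

definition smooth_maps :: "'p mfd \<Rightarrow> 'q mfd \<Rightarrow> ('p \<Rightarrow> 'q) set" where
  "smooth_maps M N = {f \<in> extensional (pts M). f ` pts M \<subseteq> pts N \<and>
     continuous_map (mfd_top M) (mfd_top N) f \<and>
     (\<forall>c\<in>atlas M. \<forall>c'\<in>atlas N. \<forall>j<mdim N.
        smooth_on (mdim M) (snd c ` {p \<in> fst c. f p \<in> fst c'}) (\<lambda>x. snd c' (f (cinv c x)) j))}"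

text \<open>The partial derivative at \<open>p\<close> in the \<open>i\<close>-th coordinate of the chart \<open>c\<close>; one-sided at corners.\<close>

definition pderiv_chart :: "'p chart \<Rightarrow> nat \<Rightarrow> ('p \<Rightarrow> 'a::real_normed_vector) \<Rightarrow> 'p \<Rightarrow> 'a" where
  "pderiv_chart c i h p = vector_derivative (\<lambda>t. h (cinv c ((snd c p)(i := t))))
     (at (snd c p i) within {t. (snd c p)(i := t) \<in> snd c ` fst c})"

definition jac :: "'p chart \<Rightarrow> 'q chart \<Rightarrow> ('p \<Rightarrow> 'q) \<Rightarrow> 'p \<Rightarrow> nat \<Rightarrow> nat \<Rightarrow> real" where
  "jac c c' f p j i = pderiv_chart c i (\<lambda>q. snd c' (f q) j) p"

definition chart_at :: "'p mfd \<Rightarrow> 'p \<Rightarrow> 'p chart" where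
  "chart_at M p = (SOME c. c \<in> atlas M \<and> p \<in> fst c)"


section \<open>Covariant tensor fields and differential forms\<close>

text \<open>
  A covariant tensor field \<open>T\<close> is given by its components: \<open>T c [i\<^sub>1, \<dots>, i\<^sub>k] p\<close> is the value of its
  degree \<open>k\<close> part at \<open>p\<close> on the coordinate vectors \<open>\<partial>\<^sub>i\<^sub>1, \<dots>, \<partial>\<^sub>i\<^sub>k\<close> of the chart \<open>c\<close>. Components of
  all degrees are kept in one function, so a form of mixed degree is a single object; components
  outside their domain of definition are 0.
\<close>

type_synonym 'p field = "'p chart \<Rightarrow> nat list \<Rightarrow> 'p \<Rightarrow> real"

definition index_lists :: "nat \<Rightarrow> nat \<Rightarrow> nat list set" where
  "index_lists n k = {I. length I = k \<and> set I \<subseteq> {..<n}}"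

definition pull_comp :: "nat \<Rightarrow> 'p chart \<Rightarrow> 'q chart \<Rightarrow> ('p \<Rightarrow> 'q) \<Rightarrow> 'q field \<Rightarrow> nat list \<Rightarrow> 'p \<Rightarrow> real" where
  "pull_comp m c c' f T I p =
     (\<Sum>J\<in>index_lists m (length I). (\<Prod>k<length I. jac c c' f p (J ! k) (I ! k)) * T c' J (f p))"

definition cov_field :: "'p mfd \<Rightarrow> 'p field \<Rightarrow> bool" where
  "cov_field M T \<longleftrightarrow>
     (\<forall>c I p. \<not> (c \<in> atlas M \<and> p \<in> fst c \<and> set I \<subseteq> {..<mdim M}) \<longrightarrow> T c I p = 0) \<and>
     (\<forall>c\<in>atlas M. \<forall>I. smooth_on (mdim M) (snd c ` fst c) (\<lambda>x. T c I (cinv c x))) \<and>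
     (\<forall>c\<in>atlas M. \<forall>c'\<in>atlas M. \<forall>p\<in>fst c \<inter> fst c'. \<forall>I. set I \<subseteq> {..<mdim M} \<longrightarrow>
        T c I p = pull_comp (mdim M) c c' (\<lambda>q. q) T I p)"

definition tensor_field :: "'p mfd \<Rightarrow> nat \<Rightarrow> 'p field \<Rightarrow> bool" where
  "tensor_field M k T \<longleftrightarrow> cov_field M T \<and> (\<forall>c I p. length I \<noteq> k \<longrightarrow> T c I p = 0)"

definition diff_form :: "'p mfd \<Rightarrow> 'p field \<Rightarrow> bool" where
  "diff_form M \<omega> \<longleftrightarrow> cov_field M \<omega> \<and>
     (\<forall>c I p \<sigma>. \<sigma> permutes {..<length I} \<longrightarrow>
        \<omega> c (map (\<lambda>k. I ! \<sigma> k) [0..<length I]) p = of_int (sign \<sigma>) * \<omega> c I p)"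

text \<open>\<open>Omega M even\<close> and \<open>Omega M odd\<close> are the total even and odd forms.\<close>

definition Omega :: "'p mfd \<Rightarrow> (nat \<Rightarrow> bool) \<Rightarrow> 'p field set" where
  "Omega M P = {\<omega>. diff_form M \<omega> \<and> (\<forall>c I p. \<not> P (length I) \<longrightarrow> \<omega> c I p = 0)}"

definition ext_d :: "'p mfd \<Rightarrow> 'p field \<Rightarrow> 'p field" where
  "ext_d M \<omega> = (\<lambda>c I p. if c \<in> atlas M \<and> p \<in> fst c \<and> set I \<subseteq> {..<mdim M}
     then \<Sum>k<length I. (-1) ^ k * pderiv_chart c (I ! k) (\<omega> c (take k I @ drop (Suc k) I)) p else 0)"

definition form_pull :: "'p mfd \<Rightarrow> 'q mfd \<Rightarrow> ('p \<Rightarrow> 'q) \<Rightarrow> 'q field \<Rightarrow> 'p field" where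
  "form_pull M N f \<omega> = (\<lambda>c I p. if c \<in> atlas M \<and> p \<in> fst c \<and> set I \<subseteq> {..<mdim M}
     then pull_comp (mdim N) c (chart_at N (f p)) f \<omega> I p else 0)"

abbreviation f_zero :: "'p field" where "f_zero \<equiv> (\<lambda>c I p. 0)"

definition f_add :: "'p field \<Rightarrow> 'p field \<Rightarrow> 'p field" where
  "f_add \<omega> \<eta> = (\<lambda>c I p. \<omega> c I p + \<eta> c I p)"

definition f_diff :: "'p field \<Rightarrow> 'p field \<Rightarrow> 'p field" where
  "f_diff \<omega> \<eta> = (\<lambda>c I p. \<omega> c I p - \<eta> c I p)"

definition form_group :: "'p field set \<Rightarrow> 'p field monoid" where
  "form_group S = \<lparr>carrier = S, mult = f_add, one = f_zero\<rparr>"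

definition closed_forms :: "'p mfd \<Rightarrow> (nat \<Rightarrow> bool) \<Rightarrow> 'p field set" where
  "closed_forms M P = {\<omega> \<in> Omega M P. ext_d M \<omega> = f_zero}"

definition exact_forms :: "'p mfd \<Rightarrow> (nat \<Rightarrow> bool) \<Rightarrow> 'p field set" where
  "exact_forms M P = ext_d M ` Omega M (\<lambda>k. P (Suc k))"

definition H_dR :: "'p mfd \<Rightarrow> (nat \<Rightarrow> bool) \<Rightarrow> 'p field set monoid" where
  "H_dR M P = form_group (closed_forms M P) Mod exact_forms M P"


section \<open>The Frechet topology on forms\<close>

definition riemannian_metric :: "'p mfd \<Rightarrow> 'p field \<Rightarrow> bool" where
  "riemannian_metric M g \<longleftrightarrow> tensor_field M 2 g \<and>
     (\<forall>c\<in>atlas M. \<forall>p\<in>fst c.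
        (\<forall>i<mdim M. \<forall>j<mdim M. g c [i, j] p = g c [j, i] p) \<and>
        (\<forall>v. (\<exists>i<mdim M. v i \<noteq> 0) \<longrightarrow> 0 < (\<Sum>i<mdim M. \<Sum>j<mdim M. g c [i, j] p * v i * v j)))"

definition tensor_prod :: "nat \<Rightarrow> 'p field \<Rightarrow> 'p field \<Rightarrow> 'p field" where
  "tensor_prod k S T = (\<lambda>c I p. S c (take k I) p * T c (drop k I) p)"

text \<open>
  A connection, given by its covariant differential on covariant tensor fields; the direction of
  differentiation is the first slot of \<open>D T\<close>. Being a derivation of the tensor product that agrees
  with the differential on functions, \<open>D\<close> is the extension of a unique affine connection.
\<close>

definition affine_connection :: "'p mfd \<Rightarrow> ('p field \<Rightarrow> 'p field) \<Rightarrow> bool" where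
  "affine_connection M D \<longleftrightarrow>
     (\<forall>k T. tensor_field M k T \<longrightarrow> tensor_field M (Suc k) (D T)) \<and>
     (\<forall>k S T a b. tensor_field M k S \<and> tensor_field M k T \<longrightarrow>
        D (\<lambda>c I p. a * S c I p + b * T c I p) = (\<lambda>c I p. a * D S c I p + b * D T c I p)) \<and>
     (\<forall>T. tensor_field M 0 T \<longrightarrow> (\<forall>c\<in>atlas M. \<forall>p\<in>fst c. \<forall>i<mdim M.
        D T c [i] p = pderiv_chart c i (T c []) p)) \<and>
     (\<forall>k l S T. tensor_field M k S \<and> tensor_field M l T \<longrightarrow>
        (\<forall>c\<in>atlas M. \<forall>p\<in>fst c. \<forall>i<mdim M. \<forall>I\<in>index_lists (mdim M) k. \<forall>J\<in>index_lists (mdim M) l.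
           D (tensor_prod k S T) c (i # I @ J) p = D S c (i # I) p * T c J p + S c I p * D T c (i # J) p))"

text \<open>\<open>sup\<^sub>p |T\<^sub>p|\<close>, where \<open>|T\<^sub>p|\<close> is the norm of \<open>T\<^sub>p\<close> as a \<open>k\<close>-linear form on the \<open>g\<close>-unit ball.
  The inserted 0 only matters for the empty manifold.\<close>

definition sup_norm :: "'p mfd \<Rightarrow> 'p field \<Rightarrow> nat \<Rightarrow> 'p field \<Rightarrow> real" where
  "sup_norm M g k T = Sup (insert 0
     {\<bar>\<Sum>I\<in>index_lists (mdim M) k. T c I p * (\<Prod>l<k. v l (I ! l))\<bar> | c p v.
        c \<in> atlas M \<and> p \<in> fst c \<and>
        (\<forall>l<k. (\<Sum>i<mdim M. \<Sum>j<mdim M. g c [i, j] p * v l i * v l j) \<le> 1)})"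

definition degree_part :: "nat \<Rightarrow> 'p field \<Rightarrow> 'p field" where
  "degree_part k \<omega> = (\<lambda>c I p. if length I = k then \<omega> c I p else 0)"

text \<open>The seminorm \<open>\<parallel>\<cdot>\<parallel>\<^sub>N\<close> of the degree \<open>k\<close> part.\<close>

definition form_seminorm :: "'p mfd \<Rightarrow> 'p field \<Rightarrow> ('p field \<Rightarrow> 'p field) \<Rightarrow> nat \<Rightarrow> nat \<Rightarrow> 'p field \<Rightarrow> real" where
  "form_seminorm M g D k N \<omega> = (\<Sum>j\<le>N. sup_norm M g (j + k) ((D ^^ j) (degree_part k \<omega>)))"

definition frechet_top :: "'p mfd \<Rightarrow> 'p field \<Rightarrow> ('p field \<Rightarrow> 'p field) \<Rightarrow> (nat \<Rightarrow> bool) \<Rightarrow> 'p field topology" where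
  "frechet_top M g D P = topology_generated_by
     {{\<eta> \<in> Omega M P. form_seminorm M g D k N (f_diff \<eta> \<omega>) < \<epsilon>} | \<omega> k N \<epsilon>. \<omega> \<in> Omega M P \<and> 0 < \<epsilon>}"


section \<open>Complex vector bundles and topological K-theory\<close>

text \<open>
  A complex vector bundle is presented as follows: choosing a basis in every fibre (without any
  continuity), the fibre over \<open>p\<close> is \<open>\<complex>\<^bsup>vrank p\<^esup>\<close>, and the topology of the bundle is given by a family
  of local frames \<open>(U, e)\<close>, the columns of \<open>e p\<close> being a basis of the fibre over \<open>p \<in> U\<close>, which are
  related to each other by continuous transition functions.
\<close>

record 'p vb =
  vrank :: "'p \<Rightarrow> nat"
  vloc :: "('p set \<times> ('p \<Rightarrow> complex mat)) set"

definition mentry :: "complex mat \<Rightarrow> nat \<Rightarrow> nat \<Rightarrow> complex" where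
  "mentry A a b = (if a < dim_row A \<and> b < dim_col A then A $$ (a, b) else 0)"

text \<open>\<open>x = y g\<close> on \<open>W\<close> for a continuous square matrix function \<open>g\<close> of size \<open>r\<close>.\<close>

definition cont_rel :: "'p mfd \<Rightarrow> 'p set \<Rightarrow> ('p \<Rightarrow> nat) \<Rightarrow> ('p \<Rightarrow> complex mat) \<Rightarrow> ('p \<Rightarrow> complex mat) \<Rightarrow> bool" where
  "cont_rel M W r x y \<longleftrightarrow> (\<exists>g. (\<forall>p\<in>W. g p \<in> carrier_mat (r p) (r p) \<and> x p = y p * g p) \<and>
     (\<forall>a b. continuous_map (subtopology (mfd_top M) W) euclidean (\<lambda>p. mentry (g p) a b)))"

definition is_vb :: "'p mfd \<Rightarrow> 'p vb \<Rightarrow> bool" where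
  "is_vb M E \<longleftrightarrow>
     (\<Union>(U, e)\<in>vloc E. U) = pts M \<and>
     (\<forall>(U, e)\<in>vloc E. openin (mfd_top M) U \<and> (\<exists>r. \<forall>p\<in>U. vrank E p = r) \<and>
        (\<forall>p\<in>U. e p \<in> carrier_mat (vrank E p) (vrank E p) \<and> invertible_mat (e p))) \<and>
     (\<forall>(U, e)\<in>vloc E. \<forall>(U', e')\<in>vloc E. cont_rel M (U \<inter> U') (vrank E) e e')"

definition vb_iso :: "'p mfd \<Rightarrow> 'p vb \<Rightarrow> 'p vb \<Rightarrow> bool" where
  "vb_iso M E F \<longleftrightarrow> (\<exists>h.
     (\<forall>p\<in>pts M. vrank E p = vrank F p \<and> h p \<in> carrier_mat (vrank E p) (vrank E p) \<and> invertible_mat (h p)) \<and>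
     (\<forall>(U, e)\<in>vloc E. \<forall>(U', e')\<in>vloc F. cont_rel M (U \<inter> U') (vrank E) (\<lambda>p. h p * e p) e'))"

definition vb_sum :: "'p vb \<Rightarrow> 'p vb \<Rightarrow> 'p vb" where
  "vb_sum E F = \<lparr>vrank = (\<lambda>p. vrank E p + vrank F p),
     vloc = {(U \<inter> U', \<lambda>p. diag_block_mat [e p, e' p]) | U e U' e'. (U, e) \<in> vloc E \<and> (U', e') \<in> vloc F}\<rparr>"

definition vb_zero :: "'p mfd \<Rightarrow> 'p vb" where
  "vb_zero M = \<lparr>vrank = (\<lambda>p. 0), vloc = {(pts M, \<lambda>p. 1\<^sub>m 0)}\<rparr>"

definition vb_pull :: "'p mfd \<Rightarrow> ('p \<Rightarrow> 'q) \<Rightarrow> 'q vb \<Rightarrow> 'p vb" where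
  "vb_pull M f E = \<lparr>vrank = (\<lambda>p. vrank E (f p)),
     vloc = {({p \<in> pts M. f p \<in> U}, \<lambda>p. e (f p)) | U e. (U, e) \<in> vloc E}\<rparr>"

text \<open>\<open>K_class M (E, F)\<close> is the class \<open>[E] - [F]\<close> in the Grothendieck group \<open>K\<^sup>0(M)\<close>.\<close>

definition K_class :: "'p mfd \<Rightarrow> 'p vb \<times> 'p vb \<Rightarrow> ('p vb \<times> 'p vb) set" where
  "K_class M = (\<lambda>(E, F). {(E', F'). is_vb M E' \<and> is_vb M F' \<and>
     (\<exists>G. is_vb M G \<and> vb_iso M (vb_sum (vb_sum E F') G) (vb_sum (vb_sum E' F) G))})"

definition K_group :: "'p mfd \<Rightarrow> ('p vb \<times> 'p vb) set monoid" where
  "K_group M = \<lparr>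
     carrier = {K_class M (E, F) | E F. is_vb M E \<and> is_vb M F},
     mult = (\<lambda>x y. \<Union>(E, F)\<in>x. \<Union>(E', F')\<in>y. K_class M (vb_sum E E', vb_sum F F')),
     one = K_class M (vb_zero M, vb_zero M)\<rparr>"

definition K_pull :: "'p mfd \<Rightarrow> ('p \<Rightarrow> 'q) \<Rightarrow> ('q vb \<times> 'q vb) set \<Rightarrow> ('p vb \<times> 'p vb) set" where
  "K_pull M f x = (\<Union>(E, F)\<in>x. K_class M (vb_pull M f E, vb_pull M f F))"


section \<open>Exterior algebra at a point\<close>

text \<open>
  An element of (matrices over) the exterior algebra of a cotangent space is a function of index
  lists, as above. The wedge product is written by the shuffle formula, summing over the set \<open>S\<close> of
  positions that go to the first factor.
\<close>

definition wedge :: "(nat list \<Rightarrow> 'a::comm_ring_1) \<Rightarrow> (nat list \<Rightarrow> 'a) \<Rightarrow> nat list \<Rightarrow> 'a" where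
  "wedge \<alpha> \<beta> I = (\<Sum>S\<in>Pow {..<length I}.
     (-1) ^ card {(a, b). a < b \<and> b \<in> S \<and> a \<in> {..<length I} - S} *
     \<alpha> (nths I S) * \<beta> (nths I ({..<length I} - S)))"

definition ext_one :: "nat list \<Rightarrow> 'a::comm_ring_1" where
  "ext_one I = (if I = [] then 1 else 0)"

type_synonym ext_mat = "nat \<Rightarrow> nat \<Rightarrow> nat list \<Rightarrow> complex"

definition ext_mat_mult :: "nat \<Rightarrow> ext_mat \<Rightarrow> ext_mat \<Rightarrow> ext_mat" where
  "ext_mat_mult r X Y = (\<lambda>a b I. \<Sum>k<r. wedge (X a k) (Y k b) I)"

primrec ext_mat_pow :: "nat \<Rightarrow> ext_mat \<Rightarrow> nat \<Rightarrow> ext_mat" where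
  "ext_mat_pow r X 0 = (\<lambda>a b. if a = b then ext_one else (\<lambda>I. 0))"
| "ext_mat_pow r X (Suc k) = ext_mat_mult r X (ext_mat_pow r X k)"

text \<open>Only used for \<open>X\<close> with entries of degree 2, where the omitted terms vanish.\<close>

definition ext_mat_fps :: "nat \<Rightarrow> complex fps \<Rightarrow> ext_mat \<Rightarrow> ext_mat" where
  "ext_mat_fps r f X = (\<lambda>a b I. \<Sum>k\<le>length I. fps_nth f k * ext_mat_pow r X k a b I)"

definition ext_trace :: "nat \<Rightarrow> ext_mat \<Rightarrow> nat list \<Rightarrow> complex" where
  "ext_trace r X I = (\<Sum>a<r. X a a I)"

definition ext_det :: "nat \<Rightarrow> ext_mat \<Rightarrow> nat list \<Rightarrow> complex" where
  "ext_det r X I = (\<Sum>\<sigma> | \<sigma> permutes {..<r}.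
     of_int (sign \<sigma>) * foldr wedge (map (\<lambda>a. X a (\<sigma> a)) [0..<r]) ext_one I)"


section \<open>Hermitian bundles with unitary connection and Chern-Weil forms\<close>

text \<open>
  A smooth Hermitian bundle with unitary connection: as before, with orthonormal identifications of
  the fibres with \<open>\<complex>\<^sup>r\<close>, unitary frames \<open>e\<close>, and for each frame the matrix \<open>A\<close> of connection forms;
  \<open>A c i p\<close> is the value of \<open>A\<close> on the coordinate vector \<open>\<partial>\<^sub>i\<close> of the chart \<open>c\<close>. In the frame \<open>e\<close> the
  covariant derivative is \<open>d + A\<close>.
\<close>

type_synonym 'p lconn = "'p chart \<Rightarrow> nat \<Rightarrow> 'p \<Rightarrow> complex mat"

record 'p hvb =
  hrank :: "'p \<Rightarrow> nat"
  hloc :: "('p set \<times> ('p \<Rightarrow> complex mat) \<times> 'p lconn) set"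

definition unitary_mat :: "nat \<Rightarrow> complex mat \<Rightarrow> bool" where
  "unitary_mat r A \<longleftrightarrow> A \<in> carrier_mat r r \<and> mat_adjoint A * A = 1\<^sub>m r"

definition mat_pderiv :: "'p chart \<Rightarrow> nat \<Rightarrow> ('p \<Rightarrow> complex mat) \<Rightarrow> 'p \<Rightarrow> complex mat" where
  "mat_pderiv c i g p = Matrix.mat (dim_row (g p)) (dim_col (g p))
     (\<lambda>(a, b). pderiv_chart c i (\<lambda>q. mentry (g q) a b) p)"

definition gauge :: "('p \<Rightarrow> complex mat) \<Rightarrow> 'p lconn \<Rightarrow> 'p lconn" where
  "gauge g A = (\<lambda>c i p. mat_adjoint (g p) * A c i p * g p + mat_adjoint (g p) * mat_pderiv c i g p)"

definition conn_pull_comp :: "nat \<Rightarrow> nat \<Rightarrow> 'p chart \<Rightarrow> 'q chart \<Rightarrow> ('p \<Rightarrow> 'q) \<Rightarrow> 'q lconn \<Rightarrow> nat \<Rightarrow> 'p \<Rightarrow> complex mat" where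
  "conn_pull_comp r m c c' f A i p = Matrix.mat r r
     (\<lambda>(a, b). \<Sum>j<m. of_real (jac c c' f p j i) * mentry (A c' j (f p)) a b)"

definition is_hvb :: "'p mfd \<Rightarrow> 'p hvb \<Rightarrow> bool" where
  "is_hvb M E \<longleftrightarrow>
     (\<Union>(U, e, A)\<in>hloc E. U) = pts M \<and>
     (\<forall>(U, e, A)\<in>hloc E. openin (mfd_top M) U \<and> (\<exists>r. \<forall>p\<in>U. hrank E p = r) \<and>
        (\<forall>p\<in>U. unitary_mat (hrank E p) (e p)) \<and>
        (\<forall>c\<in>atlas M. \<forall>i<mdim M.
           (\<forall>p\<in>U \<inter> fst c. A c i p \<in> carrier_mat (hrank E p) (hrank E p) \<and> mat_adjoint (A c i p) = - A c i p) \<and>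
           (\<forall>a b. smooth_on (mdim M) (snd c ` (U \<inter> fst c)) (\<lambda>x. mentry (A c i (cinv c x)) a b)) \<and>
           (\<forall>c'\<in>atlas M. \<forall>p\<in>U \<inter> fst c \<inter> fst c'.
              A c i p = conn_pull_comp (hrank E p) (mdim M) c c' (\<lambda>q. q) A i p))) \<and>
     (\<forall>(U, e, A)\<in>hloc E. \<forall>(U', e', A')\<in>hloc E.
        (\<forall>a b. smooth_fun M (U \<inter> U') (\<lambda>p. mentry (mat_adjoint (e p) * e' p) a b)) \<and>
        (\<forall>c\<in>atlas M. \<forall>i<mdim M. \<forall>p\<in>U \<inter> U' \<inter> fst c.
           A' c i p = gauge (\<lambda>q. mat_adjoint (e q) * e' q) A c i p))"

definition hvb_underlying :: "'p hvb \<Rightarrow> 'p vb" where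
  "hvb_underlying E = \<lparr>vrank = hrank E, vloc = {(U, e) | U e A. (U, e, A) \<in> hloc E}\<rparr>"

definition hvb_sum :: "'p hvb \<Rightarrow> 'p hvb \<Rightarrow> 'p hvb" where
  "hvb_sum E F = \<lparr>hrank = (\<lambda>p. hrank E p + hrank F p),
     hloc = {(U \<inter> U', \<lambda>p. diag_block_mat [e p, e' p], \<lambda>c i p. diag_block_mat [A c i p, A' c i p]) |
        U e A U' e' A'. (U, e, A) \<in> hloc E \<and> (U', e', A') \<in> hloc F}\<rparr>"

definition hvb_zero :: "'p mfd \<Rightarrow> 'p hvb" where
  "hvb_zero M = \<lparr>hrank = (\<lambda>p. 0), hloc = {(pts M, \<lambda>p. 1\<^sub>m 0, \<lambda>c i p. 0\<^sub>m 0 0)}\<rparr>"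

definition hvb_pull :: "'p mfd \<Rightarrow> 'q mfd \<Rightarrow> ('p \<Rightarrow> 'q) \<Rightarrow> 'q hvb \<Rightarrow> 'p hvb" where
  "hvb_pull M N f E = \<lparr>hrank = (\<lambda>p. hrank E (f p)),
     hloc = {({p \<in> pts M. f p \<in> U}, \<lambda>p. e (f p),
              \<lambda>c i p. conn_pull_comp (hrank E (f p)) (mdim N) c (chart_at N (f p)) f A i p) |
        U e A. (U, e, A) \<in> hloc E}\<rparr>"

definition hvb_isometry :: "'p mfd \<Rightarrow> 'p hvb \<Rightarrow> 'p hvb \<Rightarrow> ('p \<Rightarrow> complex mat) \<Rightarrow> bool" where
  "hvb_isometry M E F \<Phi> \<longleftrightarrow>
     (\<forall>p\<in>pts M. hrank E p = hrank F p \<and> unitary_mat (hrank E p) (\<Phi> p)) \<and>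
     (\<forall>(U, e, A)\<in>hloc E. \<forall>(U', e', A')\<in>hloc F. \<forall>a b.
        smooth_fun M (U \<inter> U') (\<lambda>p. mentry (mat_adjoint (e' p) * \<Phi> p * e p) a b))"

text \<open>\<open>F\<^sub>i\<^sub>j = \<partial>\<^sub>i A\<^sub>j - \<partial>\<^sub>j A\<^sub>i + A\<^sub>i A\<^sub>j - A\<^sub>j A\<^sub>i\<close>, the components of \<open>F = dA + A \<and> A\<close>.\<close>

definition curvature :: "'p lconn \<Rightarrow> 'p chart \<Rightarrow> nat \<Rightarrow> nat \<Rightarrow> 'p \<Rightarrow> complex mat" where
  "curvature A c i j p = mat_pderiv c i (A c j) p - mat_pderiv c j (A c i) p
     + (A c i p * A c j p - A c j p * A c i p)"

definition chern_mat :: "'p lconn \<Rightarrow> 'p chart \<Rightarrow> 'p \<Rightarrow> ext_mat" where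
  "chern_mat A c p = (\<lambda>a b I. if length I = 2
     then \<i> / (2 * of_real pi) * mentry (curvature A c (I ! 0) (I ! 1) p) a b else 0)"

definition hloc_at :: "'p hvb \<Rightarrow> 'p \<Rightarrow> 'p set \<times> ('p \<Rightarrow> complex mat) \<times> 'p lconn" where
  "hloc_at E p = (SOME t. t \<in> hloc E \<and> p \<in> fst t)"

text \<open>The real part in the definitions below is only a type conversion: for unitary connections
  the forms are real.\<close>

definition chern_weil ::
  "(nat \<Rightarrow> ext_mat \<Rightarrow> nat list \<Rightarrow> complex) \<Rightarrow> 'p mfd \<Rightarrow> 'p hvb \<Rightarrow> 'p field" where
  "chern_weil \<phi> M E = (\<lambda>c I p. if c \<in> atlas M \<and> p \<in> fst c \<and> set I \<subseteq> {..<mdim M}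
     then Re (\<phi> (hrank E p) (chern_mat (snd (snd (hloc_at E p))) c p) I) else 0)"

definition ch_form :: "'p mfd \<Rightarrow> 'p hvb \<Rightarrow> 'p field" where
  "ch_form = chern_weil (\<lambda>r X. ext_trace r (ext_mat_fps r (fps_exp 1) X))"

definition todd_form :: "'p mfd \<Rightarrow> 'p hvb \<Rightarrow> 'p field" where
  "todd_form = chern_weil (\<lambda>r X. ext_det r (ext_mat_fps r (fps_X / (1 - fps_exp (-1))) X))"

text \<open>
  The Chern-Simons form \<open>\<integral>\<^sub>0\<^sup>1 tr ((i/2\<pi>) (B - A) \<and> exp ((i/2\<pi>) F\<^sub>t)) dt\<close> of the path \<open>(1 - t) A + t B\<close>
  from the connection \<open>A\<close> of \<open>E\<close> to the pullback \<open>B\<close> by \<open>\<Phi>\<close> of the connection of \<open>F\<close>. Its exterior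
  derivative is \<open>ch F - ch E\<close>.
\<close>

definition cs_form :: "'p mfd \<Rightarrow> 'p hvb \<Rightarrow> 'p hvb \<Rightarrow> ('p \<Rightarrow> complex mat) \<Rightarrow> 'p field" where
  "cs_form M E F \<Phi> = (\<lambda>c I p. if c \<in> atlas M \<and> p \<in> fst c \<and> set I \<subseteq> {..<mdim M} then
     (let r = hrank E p;
          (U, e, A) = hloc_at E p;
          (U', e', A') = hloc_at F p;
          B = gauge (\<lambda>q. mat_adjoint (e' q) * \<Phi> q * e q) A';
          At = (\<lambda>t c i q. complex_of_real (1 - t) \<cdot>\<^sub>m A c i q + complex_of_real t \<cdot>\<^sub>m B c i q);
          Y = (\<lambda>a b J. if length J = 1
                 then \<i> / (2 * of_real pi) * mentry (B c (J ! 0) p - A c (J ! 0) p) a b else 0)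
      in integral {0..1} (\<lambda>t. Re (ext_trace r
           (ext_mat_mult r Y (ext_mat_fps r (fps_exp 1) (chern_mat (At t) c p))) I)))
     else 0)"

text \<open>The Chern character \<open>K\<^sup>0(M) \<rightarrow> H\<^sup>e\<^sup>v(M)\<close>, through Hermitian bundles with connection
  representing the K-theory class.\<close>

definition chern_character :: "'p mfd \<Rightarrow> ('p vb \<times> 'p vb) set \<Rightarrow> 'p field set" where
  "chern_character M x = (\<Union>(E, F)\<in>{(E, F). is_hvb M E \<and> is_hvb M F \<and> (hvb_underlying E, hvb_underlying F) \<in> x}.
     exact_forms M even #>\<^bsub>form_group (closed_forms M even)\<^esub> f_diff (ch_form M E) (ch_form M F))"


section \<open>K-theory with coefficients in \<open>\<real>/\<int>\<close>\<close>

text \<open>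
  The model of Karoubi and Lott for \<open>K\<^sup>-\<^sup>1(M; \<real>/\<int>)\<close>: cycles are \<open>(E, F, \<omega>)\<close> with \<open>E\<close>, \<open>F\<close> Hermitian
  bundles with unitary connection and \<open>\<omega>\<close> an odd form such that \<open>ch E - ch F + d\<omega> = 0\<close>. Two cycles
  are equivalent if for some \<open>G\<close> there is an isometry from \<open>E \<oplus> F' \<oplus> G\<close> to \<open>E' \<oplus> F \<oplus> G\<close> whose
  Chern-Simons form is \<open>\<omega> - \<omega>'\<close> up to exact forms.
\<close>

type_synonym 'p rz_cycle = "'p hvb \<times> 'p hvb \<times> 'p field"

definition rz_cycles :: "'p mfd \<Rightarrow> 'p rz_cycle set" where
  "rz_cycles M = {(E, F, \<omega>). is_hvb M E \<and> is_hvb M F \<and> \<omega> \<in> Omega M odd \<and>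
     f_add (f_diff (ch_form M E) (ch_form M F)) (ext_d M \<omega>) = f_zero}"

definition rz_class :: "'p mfd \<Rightarrow> 'p rz_cycle \<Rightarrow> 'p rz_cycle set" where
  "rz_class M = (\<lambda>(E, F, \<omega>). {(E', F', \<omega>'). (E', F', \<omega>') \<in> rz_cycles M \<and>
     (\<exists>G \<Phi>. is_hvb M G \<and>
        (let L = hvb_sum (hvb_sum E F') G; R = hvb_sum (hvb_sum E' F) G in
          hvb_isometry M L R \<Phi> \<and> f_diff (f_diff \<omega> \<omega>') (cs_form M L R \<Phi>) \<in> exact_forms M odd))})"

definition KRZ_group :: "'p mfd \<Rightarrow> 'p rz_cycle set monoid" where
  "KRZ_group M = \<lparr>
     carrier = rz_class M ` rz_cycles M,
     mult = (\<lambda>x y. \<Union>(E, F, \<omega>)\<in>x. \<Union>(E', F', \<omega>')\<in>y. rz_class M (hvb_sum E E', hvb_sum F F', f_add \<omega> \<omega>')),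
     one = rz_class M (hvb_zero M, hvb_zero M, f_zero)\<rparr>"

definition KRZ_pull :: "'p mfd \<Rightarrow> 'q mfd \<Rightarrow> ('p \<Rightarrow> 'q) \<Rightarrow> 'q rz_cycle set \<Rightarrow> 'p rz_cycle set" where
  "KRZ_pull M N f x =
     (\<Union>(E, F, \<omega>)\<in>x. rz_class M (hvb_pull M N f E, hvb_pull M N f F, form_pull M N f \<omega>))"

definition mod_Z :: "'p mfd \<Rightarrow> 'p field set \<Rightarrow> 'p rz_cycle set" where
  "mod_Z M h = (\<Union>\<theta>\<in>h. rz_class M (hvb_zero M, hvb_zero M, \<theta>))"

definition bockstein :: "'p mfd \<Rightarrow> 'p rz_cycle set \<Rightarrow> ('p vb \<times> 'p vb) set" where
  "bockstein M x = (\<Union>(E, F, \<omega>)\<in>x. K_class M (hvb_underlying E, hvb_underlying F))"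


section \<open>SAC cycles and forms with integer periods\<close>

text \<open>
  A stably almost complex manifold \<open>V\<close>, together with the choice of a Hermitian metric and a unitary
  connection on its stable tangent bundle: the latter is the complex bundle \<open>sac_bundle\<close>, identified
  with \<open>TV \<oplus> \<real>\<^sup>k\<close> by the real isomorphism \<open>sac_iso\<close>. The columns of \<open>sac_iso c p\<close> are the images of
  \<open>\<partial>\<^sub>1, \<dots>, \<partial>\<^sub>n\<close> (coordinate vectors of the chart \<open>c\<close>) and of the standard basis of \<open>\<real>\<^sup>k\<close>.
  A manifold has at most continuum many points, so it is no loss to take \<open>real\<close> as the type of
  points of \<open>V\<close>.
\<close>

record sac =
  sac_mfd :: "real mfd"
  sac_k :: nat
  sac_bundle :: "real hvb"
  sac_iso :: "real chart \<Rightarrow> real \<Rightarrow> complex mat"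

definition real_iso_det :: "sac \<Rightarrow> real chart \<Rightarrow> real \<Rightarrow> real" where
  "real_iso_det V c p = (let N = mdim (sac_mfd V) + sac_k V in
     Determinant.det (Matrix.mat N N (\<lambda>(a, b). (if even a then Re else Im) (sac_iso V c p $$ (a div 2, b)))))"

definition is_sac :: "sac \<Rightarrow> bool" where
  "is_sac V \<longleftrightarrow> (let M = sac_mfd V; n = mdim M; N = n + sac_k V; E = sac_bundle V; \<rho> = sac_iso V in
     closed_mfd M \<and> is_hvb M E \<and> (\<forall>p\<in>pts M. 2 * hrank E p = N) \<and>
     (\<forall>c\<in>atlas M. \<forall>p\<in>fst c. \<rho> c p \<in> carrier_mat (hrank E p) N \<and> real_iso_det V c p \<noteq> 0) \<and>
     (\<forall>c\<in>atlas M. \<forall>c'\<in>atlas M. \<forall>p\<in>fst c \<inter> fst c'. \<forall>a<hrank E p.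
        (\<forall>i<n. \<rho> c p $$ (a, i) = (\<Sum>j<n. of_real (jac c c' (\<lambda>q. q) p j i) * \<rho> c' p $$ (a, j))) \<and>
        (\<forall>i\<in>{n..<N}. \<rho> c p $$ (a, i) = \<rho> c' p $$ (a, i))) \<and>
     (\<forall>c\<in>atlas M. \<forall>(U, e, A)\<in>hloc E. \<forall>a b.
        smooth_on n (snd c ` (U \<inter> fst c))
          (\<lambda>x. mentry (mat_adjoint (e (cinv c x)) * \<rho> c (cinv c x)) a b)))"

text \<open>The sign of the chart \<open>c\<close> at \<open>p\<close> with respect to the orientation of \<open>V\<close> that is induced from
  the complex orientation of the stable tangent bundle and the standard orientation of \<open>\<real>\<^sup>k\<close>.\<close>

definition sac_orient :: "sac \<Rightarrow> real chart \<Rightarrow> real \<Rightarrow> real" where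
  "sac_orient V c p = sgn (real_iso_det V c p)"

definition partition_of_unity :: "'p mfd \<Rightarrow> nat \<Rightarrow> (nat \<Rightarrow> 'p chart) \<Rightarrow> (nat \<Rightarrow> 'p \<Rightarrow> real) \<Rightarrow> bool" where
  "partition_of_unity M m cs u \<longleftrightarrow>
     (\<forall>a<m. cs a \<in> atlas M \<and> smooth_fun M (pts M) (u a) \<and> (\<forall>p\<in>pts M. 0 \<le> u a p) \<and>
        (\<exists>S. closedin (mfd_top M) S \<and> S \<subseteq> fst (cs a) \<and> (\<forall>p\<in>pts M - S. u a p = 0))) \<and>
     (\<forall>p\<in>pts M. (\<Sum>a<m. u a p) = 1)"

text \<open>The integral over the oriented closed manifold \<open>V\<close> of the top degree part of \<open>\<eta>\<close>, computed with
  the partition of unity \<open>u\<close>.\<close>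

definition has_form_integral ::
  "sac \<Rightarrow> nat \<Rightarrow> (nat \<Rightarrow> real chart) \<Rightarrow> (nat \<Rightarrow> real \<Rightarrow> real) \<Rightarrow> real field \<Rightarrow> real \<Rightarrow> bool" where
  "has_form_integral V m cs u \<eta> z \<longleftrightarrow> (let n = mdim (sac_mfd V) in \<exists>J.
     (\<forall>a<m. has_bochner_integral (Pi\<^sub>M {..<n} (\<lambda>_. lborel))
        (\<lambda>x. let y = (\<lambda>i. if i < n then x i else 0); p = cinv (cs a) y in
           if y \<in> snd (cs a) ` fst (cs a)
           then sac_orient V (cs a) p * u a p * \<eta> (cs a) [0..<n] p else 0) (J a)) \<and>
     z = (\<Sum>a<m. J a))"

definition form_wedge :: "'p field \<Rightarrow> 'p field \<Rightarrow> 'p field" where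
  "form_wedge \<omega> \<eta> = (\<lambda>c I p. wedge (\<lambda>J. \<omega> c J p) (\<lambda>J. \<eta> c J p) I)"

text \<open>\<open>int_forms M even\<close> is \<open>\<Omega>\<^sub>B\<^sub>U(M)\<close> and \<open>int_forms M odd\<close> is \<open>\<Omega>\<^sub>U(M)\<close>.\<close>

definition int_forms :: "'p mfd \<Rightarrow> (nat \<Rightarrow> bool) \<Rightarrow> 'p field set" where
  "int_forms M P = {\<omega> \<in> closed_forms M P.
     \<forall>V f m cs u. is_sac V \<and> P (mdim (sac_mfd V)) \<and> f \<in> smooth_maps (sac_mfd V) M \<and>
        partition_of_unity (sac_mfd V) m cs u \<longrightarrow>
        (\<exists>z::int. has_form_integral V m cs u
           (form_wedge (form_pull (sac_mfd V) M f \<omega>) (todd_form (sac_mfd V) (sac_bundle V))) (of_int z))}"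

definition Omega_BU :: "'p mfd \<Rightarrow> 'p field monoid" where
  "Omega_BU M = form_group (int_forms M even)"

definition Omega_odd_mod_U :: "'p mfd \<Rightarrow> 'p field set monoid" where
  "Omega_odd_mod_U M = form_group (Omega M odd) Mod int_forms M odd"

definition U_coset :: "'p mfd \<Rightarrow> 'p field \<Rightarrow> 'p field set" where
  "U_coset M \<omega> = int_forms M odd #>\<^bsub>form_group (Omega M odd)\<^esub> \<omega>"

definition U_pull :: "'p mfd \<Rightarrow> 'q mfd \<Rightarrow> ('p \<Rightarrow> 'q) \<Rightarrow> 'q field set \<Rightarrow> 'p field set" where
  "U_pull M N f C = (\<Union>\<omega>\<in>C. U_coset M (form_pull M N f \<omega>))"

definition deR_BU :: "'p mfd \<Rightarrow> 'p field \<Rightarrow> 'p field set" where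
  "deR_BU M \<omega> = exact_forms M even #>\<^bsub>form_group (closed_forms M even)\<^esub> \<omega>"

definition deR_odd :: "'p mfd \<Rightarrow> 'p field set \<Rightarrow> 'p field set" where
  "deR_odd M h = (\<Union>\<theta>\<in>h. U_coset M \<theta>)"

definition d_induced :: "'p mfd \<Rightarrow> 'p field set \<Rightarrow> 'p field" where
  "d_induced M C = the_elem (ext_d M ` C)"


section \<open>Differential K-functors\<close>

definition short_exact ::
  "('a, 'x) monoid_scheme \<Rightarrow> ('b, 'y) monoid_scheme \<Rightarrow> ('c, 'z) monoid_scheme \<Rightarrow> ('a \<Rightarrow> 'b) \<Rightarrow> ('b \<Rightarrow> 'c) \<Rightarrow> bool" where
  "short_exact A B C f g \<longleftrightarrow> f \<in> hom A B \<and> g \<in> hom B C \<and> inj_on f (carrier A) \<and>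
     f ` carrier A = kernel B C g \<and> g ` carrier B = carrier C"

record ('p, 'k) dK =
  dK_obj :: "'p mfd \<Rightarrow> 'k monoid"
  dK_map :: "'p mfd \<Rightarrow> 'p mfd \<Rightarrow> ('p \<Rightarrow> 'p) \<Rightarrow> 'k \<Rightarrow> 'k"
  dK_i :: "'p mfd \<Rightarrow> 'p field set \<Rightarrow> 'k"
  dK_j :: "'p mfd \<Rightarrow> 'p rz_cycle set \<Rightarrow> 'k"
  dK_delta :: "'p mfd \<Rightarrow> 'k \<Rightarrow> ('p vb \<times> 'p vb) set"
  dK_ch :: "'p mfd \<Rightarrow> 'k \<Rightarrow> 'p field"

definition contravariant_functor :: "('p, 'k) dK \<Rightarrow> bool" where
  "contravariant_functor K \<longleftrightarrow>
     (\<forall>M. compact_mfd M \<longrightarrow> comm_group (dK_obj K M) \<and>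
        (\<forall>x\<in>carrier (dK_obj K M). dK_map K M M (\<lambda>p\<in>pts M. p) x = x)) \<and>
     (\<forall>M N f. compact_mfd M \<and> compact_mfd N \<and> f \<in> smooth_maps M N \<longrightarrow>
        dK_map K M N f \<in> hom (dK_obj K N) (dK_obj K M)) \<and>
     (\<forall>M N L f g. compact_mfd M \<and> compact_mfd N \<and> compact_mfd L \<and>
        f \<in> smooth_maps M N \<and> g \<in> smooth_maps N L \<longrightarrow>
        (\<forall>x\<in>carrier (dK_obj K L).
           dK_map K M L (compose (pts M) g f) x = dK_map K M N f (dK_map K N L g x)))"

definition natural_maps :: "('p, 'k) dK \<Rightarrow> bool" where
  "natural_maps K \<longleftrightarrow> (\<forall>M N f. compact_mfd M \<and> compact_mfd N \<and> f \<in> smooth_maps M N \<longrightarrow>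
     (\<forall>C\<in>carrier (Omega_odd_mod_U N). dK_i K M (U_pull M N f C) = dK_map K M N f (dK_i K N C)) \<and>
     (\<forall>y\<in>carrier (KRZ_group N). dK_j K M (KRZ_pull M N f y) = dK_map K M N f (dK_j K N y)) \<and>
     (\<forall>x\<in>carrier (dK_obj K N). dK_delta K M (dK_map K M N f x) = K_pull M f (dK_delta K N x)) \<and>
     (\<forall>x\<in>carrier (dK_obj K N). dK_ch K M (dK_map K M N f x) = form_pull M N f (dK_ch K N x)))"

definition differential_K_functor :: "('p, 'k) dK \<Rightarrow> bool" where
  "differential_K_functor K \<longleftrightarrow> contravariant_functor K \<and> natural_maps K \<and>
     (\<forall>M. compact_mfd M \<longrightarrow>
        short_exact (Omega_odd_mod_U M) (dK_obj K M) (K_group M) (dK_i K M) (dK_delta K M) \<and>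
        short_exact (KRZ_group M) (dK_obj K M) (Omega_BU M) (dK_j K M) (dK_ch K M) \<and>
        (\<forall>h\<in>carrier (H_dR M odd). dK_i K M (deR_odd M h) = dK_j K M (mod_Z M h)) \<and>
        (\<forall>y\<in>carrier (KRZ_group M). dK_delta K M (dK_j K M y) = bockstein M y) \<and>
        (\<forall>C\<in>carrier (Omega_odd_mod_U M). dK_ch K M (dK_i K M C) = d_induced M C) \<and>
        (\<forall>x\<in>carrier (dK_obj K M). deR_BU M (dK_ch K M x) = chern_character M (dK_delta K M x)))"


section \<open>Topological groups and strict exactness\<close>

definition topological_group :: "('a, 'x) monoid_scheme \<Rightarrow> 'a topology \<Rightarrow> bool" where
  "topological_group G T \<longleftrightarrow> group G \<and> topspace T = carrier G \<and>
     continuous_map (prod_topology T T) T (\<lambda>(x, y). x \<otimes>\<^bsub>G\<^esub> y) \<and>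
     continuous_map T T (\<lambda>x. inv\<^bsub>G\<^esub> x)"

definition strict_map :: "'a topology \<Rightarrow> 'b topology \<Rightarrow> ('a \<Rightarrow> 'b) \<Rightarrow> bool" where
  "strict_map S T h \<longleftrightarrow> continuous_map S T h \<and> open_map S (subtopology T (h ` topspace S)) h"

text \<open>The homomorphisms from and to the zero groups are always continuous and strict.\<close>

definition strictly_short_exact ::
  "('a, 'x) monoid_scheme \<Rightarrow> 'a topology \<Rightarrow> ('b, 'y) monoid_scheme \<Rightarrow> 'b topology \<Rightarrow>
   ('c, 'z) monoid_scheme \<Rightarrow> 'c topology \<Rightarrow> ('a \<Rightarrow> 'b) \<Rightarrow> ('b \<Rightarrow> 'c) \<Rightarrow> bool" where
  "strictly_short_exact A S B T C R f g \<longleftrightarrow>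
     short_exact A B C f g \<and> strict_map S T f \<and> strict_map T R g"

definition quotient_top :: "'a topology \<Rightarrow> ('a \<Rightarrow> 'b) \<Rightarrow> 'b topology" where
  "quotient_top X q = topology (\<lambda>W. W \<subseteq> q ` topspace X \<and> openin X {x \<in> topspace X. q x \<in> W})"

definition Omega_odd_mod_U_top :: "'p mfd \<Rightarrow> 'p field \<Rightarrow> ('p field \<Rightarrow> 'p field) \<Rightarrow> 'p field set topology" where
  "Omega_odd_mod_U_top M g D = quotient_top (frechet_top M g D odd) (U_coset M)"

definition strict_topology :: "('p, 'k) dK \<Rightarrow> 'p mfd \<Rightarrow> 'p field \<Rightarrow> ('p field \<Rightarrow> 'p field) \<Rightarrow> 'k topology \<Rightarrow> bool" where
  "strict_topology K M g D T \<longleftrightarrow> topological_group (dK_obj K M) T \<and>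
     strictly_short_exact
       (Omega_odd_mod_U M) (Omega_odd_mod_U_top M g D)
       (dK_obj K M) T
       (K_group M) (discrete_topology (carrier (K_group M)))
       (dK_i K M) (dK_delta K M)"

end

(*
  In a group topology making 0 -> A -> G -> C -> 0 strictly exact, with C discrete, the image of A is
  an open subgroup homeomorphic to A. Hence W is open in G iff for every x in G the set of all a in A
  with x i(a) in W is open in A; this determines the topology, and conversely defines one as soon as A
  is a topological group. The group C only enters through the fact that the kernel is clopen, so that
  the identity component of G is the image of A if A is connected.

  That the quotient of the odd forms by the forms with integer periods is a connected topological
  group follows from the same statement for the forms, whose topology is given by seminorms. The one
  analytic point is that these seminorms are finite: by compactness of M it suffices to bound a tensor
  field on metric unit vectors near a point, in a fixed chart there, as both the tensor field and the
  metric transform under a change of charts; and near a point the coordinates of unit vectors are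
  bounded since the metric is positive definite.
*)

theory Submission
  imports Defs
begin

section \<open>Topological groups\<close>

text \<open>Open sets, derivatives and suprema are given by total operators,
  \<open>topology\<close>, \<open>vector_derivative\<close> and \<open>Sup\<close>, which say
  nothing unless a condition holds. This decides what has to be proved about forms. The exterior
  derivative is seen to be linear only after partial derivatives are known to exist and to be
  unique, also at corners, where they are one-sided; that the closed forms, and with them the forms
  with integer periods, are a subgroup depends on it. The triangle inequality for the seminorms
  depends on the sets under \<open>Sup\<close> being bounded. Commutativity of the differential
  K-group is what makes the multiplication of the extension continuous: in x i(a) y i(b) the element
  i(a) can be moved past y, whereas in a general extension conjugation by y would have to act
  continuously on A.\<close>

lemma openin_topology_iff:
  assumes "istopology P"
  shows "openin (topology P) W \<longleftrightarrow> P W"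
  using assms by (simp add: topology_inverse')

text \<open>\<open>quotient_top\<close> is \<open>topology\<close> of a predicate, which is
  informative only once the predicate is closed under binary intersections and arbitrary unions;
  preimages under \<open>q\<close> commute with both.\<close>

lemma quotient_map_quotient_top: "quotient_map X (quotient_top X q) q"
proof -
  have "istopology (\<lambda>W. W \<subseteq> q ` topspace X \<and> openin X {x \<in> topspace X. q x \<in> W})"
  proof -
    have "{x \<in> topspace X. q x \<in> S \<inter> T} = {x \<in> topspace X. q x \<in> S} \<inter> {x \<in> topspace X. q x \<in> T}" for S T
      by blast
    moreover have "{x \<in> topspace X. q x \<in> \<Union>\<K>} = (\<Union>W\<in>\<K>. {x \<in> topspace X. q x \<in> W})" for \<K>
      by blast
    ultimately show ?thesis
      unfolding istopology_def by (auto simp: openin_clauses)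
  qed
  then have op: "openin (quotient_top X q) W \<longleftrightarrow>
      W \<subseteq> q ` topspace X \<and> openin X {x \<in> topspace X. q x \<in> W}" for W
    unfolding quotient_top_def by (rule openin_topology_iff)
  have "{x \<in> topspace X. q x \<in> q ` topspace X} = topspace X"
    by blast
  then have "topspace (quotient_top X q) = q ` topspace X"
    using op[of "q ` topspace X"] op openin_subset by (metis openin_topspace subset_antisym subset_refl)
  then show ?thesis
    unfolding quotient_map_def using op by auto
qed

lemma topological_group_translation:
  assumes "topological_group G T" and "x \<in> carrier G"
  shows "continuous_map T T (\<lambda>y. x \<otimes>\<^bsub>G\<^esub> y)"
proof -
  have "continuous_map T (prod_topology T T) (\<lambda>y. (x, y))"
    using assms by (auto simp: continuous_map_paired topological_group_def)
  moreover have "continuous_map (prod_topology T T) T (\<lambda>(x, y). x \<otimes>\<^bsub>G\<^esub> y)"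
    using assms by (simp add: topological_group_def)
  ultimately have "continuous_map T T ((\<lambda>(x, y). x \<otimes>\<^bsub>G\<^esub> y) \<circ> (\<lambda>y. (x, y)))"
    by (rule continuous_map_compose)
  then show ?thesis
    by (simp add: o_def)
qed

text \<open>The image of W under translation by x is its preimage under translation by the inverse
  of x.\<close>

lemma topological_group_translate_open:
  assumes "topological_group G T" and x: "x \<in> carrier G" and W: "openin T W"
  shows "openin T ((\<lambda>y. x \<otimes>\<^bsub>G\<^esub> y) ` W)"
proof -
  interpret group G using assms by (simp add: topological_group_def)
  have sub: "W \<subseteq> carrier G" and top: "topspace T = carrier G"
    using openin_subset[OF W] assms by (auto simp: topological_group_def)
  have "(\<lambda>y. x \<otimes>\<^bsub>G\<^esub> y) ` W = {y \<in> topspace T. inv\<^bsub>G\<^esub> x \<otimes>\<^bsub>G\<^esub> y \<in> W}"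
  proof (intro Set.set_eqI iffI)
    fix y assume "y \<in> {y \<in> topspace T. inv\<^bsub>G\<^esub> x \<otimes>\<^bsub>G\<^esub> y \<in> W}"
    then show "y \<in> (\<lambda>y. x \<otimes>\<^bsub>G\<^esub> y) ` W"
      using x top by (intro image_eqI[of _ _ "inv\<^bsub>G\<^esub> x \<otimes>\<^bsub>G\<^esub> y"]) (auto simp: m_assoc[symmetric])
  next
    fix y assume "y \<in> (\<lambda>y. x \<otimes>\<^bsub>G\<^esub> y) ` W"
    then show "y \<in> {y \<in> topspace T. inv\<^bsub>G\<^esub> x \<otimes>\<^bsub>G\<^esub> y \<in> W}"
      using x top sub by (auto simp: m_assoc[symmetric] subset_iff)
  qed
  then show ?thesis
    using openin_continuous_map_preimage[OF topological_group_translation[OF assms(1)] W] x by simp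
qed

text \<open>A product of two quotient maps need not be a quotient map, but a product of open maps is
  open, since boxes go to boxes. This is what lets the multiplication descend to a quotient
  group.\<close>

lemma open_map_prod:
  assumes "open_map X X' f" and "open_map Y Y' g"
  shows "open_map (prod_topology X Y) (prod_topology X' Y') (\<lambda>(x, y). (f x, g y))"
  unfolding open_map_def
proof (intro allI impI)
  fix W assume W: "openin (prod_topology X Y) W"
  show "openin (prod_topology X' Y') ((\<lambda>(x, y). (f x, g y)) ` W)"
    unfolding openin_prod_topology_alt
  proof (intro allI impI)
    fix a b assume "(a, b) \<in> (\<lambda>(x, y). (f x, g y)) ` W"
    then obtain x y where xy: "(x, y) \<in> W" "a = f x" "b = g y"
      by auto
    then obtain U V where "openin X U" "openin Y V" "x \<in> U" "y \<in> V" "U \<times> V \<subseteq> W"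
      using W unfolding openin_prod_topology_alt by meson
    then show "\<exists>U V. openin X' U \<and> openin Y' V \<and> a \<in> U \<and> b \<in> V \<and>
        U \<times> V \<subseteq> (\<lambda>(x, y). (f x, g y)) ` W"
      using assms xy by (intro exI[of _ "f ` U"] exI[of _ "g ` V"]) (auto simp: open_map_def)
  qed
qed

text \<open>The projection \<open>q\<close> is open, as the saturation of an open W is the union of
  its translates by elements of N. Hence the product of \<open>q\<close> with itself is a quotient
  map, and continuity of multiplication and inversion can be tested before projecting.\<close>

lemma topological_group_quotient:
  fixes G :: "('a, 'x) monoid_scheme"
  assumes X: "topological_group G X" and "N \<lhd> G"
  defines "q \<equiv> \<lambda>a. N #>\<^bsub>G\<^esub> a"
  shows "topological_group (G Mod N) (quotient_top X q)"
proof -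
  interpret normal N G by fact
  let ?Q = "quotient_top X q"
  have top: "topspace X = carrier G"
    using X by (simp add: topological_group_def)
  have car: "carrier (G Mod N) = q ` carrier G"
    by (auto simp: carrier_FactGroup q_def)
  have quo: "quotient_map X ?Q q"
    by (rule quotient_map_quotient_top)
  then have cq: "continuous_map X ?Q q" and topQ: "topspace ?Q = carrier (G Mod N)"
    by (simp_all add: quotient_imp_continuous_map quotient_imp_surjective_map[OF quo, symmetric] car top)
  have qeq: "q a = q b \<longleftrightarrow> (\<exists>n\<in>N. a = n \<otimes>\<^bsub>G\<^esub> b)" if "a \<in> carrier G" "b \<in> carrier G" for a b
  proof
    assume "q a = q b"
    then have "a \<in> q b"
      using that rcos_self[of a N] subgroup_axioms unfolding q_def by metis
    then show "\<exists>n\<in>N. a = n \<otimes>\<^bsub>G\<^esub> b"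
      by (auto simp: q_def r_coset_def)
  next
    assume "\<exists>n\<in>N. a = n \<otimes>\<^bsub>G\<^esub> b"
    then have "a \<in> q b"
      by (auto simp: q_def r_coset_def)
    then show "q a = q b"
      using repr_independence[of a N b] that subgroup_axioms unfolding q_def by metis
  qed
  have open_q: "open_map X ?Q q"
    unfolding open_map_def
  proof (intro allI impI)
    fix W assume W: "openin X W"
    then have sub: "W \<subseteq> carrier G"
      using openin_subset top by blast
    have "{a \<in> topspace X. q a \<in> q ` W} = (\<Union>n\<in>N. (\<lambda>b. n \<otimes>\<^bsub>G\<^esub> b) ` W)"
    proof (intro Set.set_eqI iffI)
      fix a assume a: "a \<in> {a \<in> topspace X. q a \<in> q ` W}"
      then obtain b where b: "b \<in> W" "q a = q b"
        by blast
      then obtain n where "n \<in> N" "a = n \<otimes>\<^bsub>G\<^esub> b"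
        using qeq[of a b] a sub top by blast
      then show "a \<in> (\<Union>n\<in>N. (\<lambda>b. n \<otimes>\<^bsub>G\<^esub> b) ` W)"
        using b by blast
    next
      fix a assume "a \<in> (\<Union>n\<in>N. (\<lambda>b. n \<otimes>\<^bsub>G\<^esub> b) ` W)"
      then obtain n b where nb: "n \<in> N" "b \<in> W" "a = n \<otimes>\<^bsub>G\<^esub> b"
        by blast
      then have "a \<in> carrier G" "b \<in> carrier G"
        using sub subset by auto
      then have "q a = q b"
        using qeq nb by blast
      then show "a \<in> {a \<in> topspace X. q a \<in> q ` W}"
        using \<open>a \<in> carrier G\<close> nb(2) top by blast
    qed
    moreover have "openin X (\<Union>n\<in>N. (\<lambda>b. n \<otimes>\<^bsub>G\<^esub> b) ` W)"
      using topological_group_translate_open[OF X _ W] by (auto intro!: openin_Union)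
    ultimately have "openin X {a \<in> topspace X. q a \<in> q ` W}"
      by simp
    moreover have "q ` W \<subseteq> topspace ?Q"
      using sub by (auto simp: topQ car)
    ultimately show "openin ?Q (q ` W)"
      using quo by (simp add: quotient_map_def)
  qed
  let ?m = "\<lambda>(a, b). a \<otimes>\<^bsub>G Mod N\<^esub> b"
  have "quotient_map (prod_topology X X) (prod_topology ?Q ?Q) (\<lambda>(a, b). (q a, q b))"
  proof (rule continuous_open_imp_quotient_map)
    show "continuous_map (prod_topology X X) (prod_topology ?Q ?Q) (\<lambda>(a, b). (q a, q b))"
      using cq by (simp add: continuous_map_prod_top)
    show "open_map (prod_topology X X) (prod_topology ?Q ?Q) (\<lambda>(a, b). (q a, q b))"
      using open_q by (simp add: open_map_prod)
    show "(\<lambda>(a, b). (q a, q b)) ` topspace (prod_topology X X) = topspace (prod_topology ?Q ?Q)"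
      by (auto simp: topQ top car image_iff)
  qed
  moreover have "continuous_map (prod_topology X X) ?Q (?m \<circ> (\<lambda>(a, b). (q a, q b)))"
  proof (rule continuous_map_eq)
    show "continuous_map (prod_topology X X) ?Q (q \<circ> (\<lambda>(a, b). a \<otimes>\<^bsub>G\<^esub> b))"
      using X cq by (auto simp: topological_group_def intro: continuous_map_compose)
  qed (auto simp: top q_def rcos_sum)
  ultimately have "continuous_map (prod_topology ?Q ?Q) ?Q ?m"
    by (rule continuous_compose_quotient_map)
  moreover have "continuous_map ?Q ?Q (\<lambda>a. inv\<^bsub>G Mod N\<^esub> a)"
  proof (rule continuous_compose_quotient_map[OF quo], rule continuous_map_eq)
    show "continuous_map X ?Q (q \<circ> (\<lambda>a. inv\<^bsub>G\<^esub> a))"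
      using X cq by (auto simp: topological_group_def intro: continuous_map_compose)
  next
    fix a assume "a \<in> topspace X"
    then show "(q \<circ> (\<lambda>a. inv\<^bsub>G\<^esub> a)) a = ((\<lambda>a. inv\<^bsub>G Mod N\<^esub> a) \<circ> q) a"
      using inv_FactGroup[of "q a"] by (simp add: top car q_def rcos_inv)
  qed
  ultimately show ?thesis
    using topQ factorgroup_is_group by (simp add: topological_group_def)
qed

section \<open>Extensions of a discrete group by a topological group\<close>

definition extension_top ::
  "('a, 'x) monoid_scheme \<Rightarrow> 'a topology \<Rightarrow> ('b, 'y) monoid_scheme \<Rightarrow> ('a \<Rightarrow> 'b) \<Rightarrow> 'b topology" where
  "extension_top A S G f = topology (\<lambda>W. W \<subseteq> carrier G \<and>
     (\<forall>x\<in>carrier G. openin S {a \<in> carrier A. x \<otimes>\<^bsub>G\<^esub> f a \<in> W}))"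

locale discrete_extension =
  fixes A :: "('a, 'x) monoid_scheme" and S :: "'a topology"
    and G :: "('b, 'y) monoid_scheme" and C :: "('c, 'z) monoid_scheme"
    and f :: "'a \<Rightarrow> 'b" and h :: "'b \<Rightarrow> 'c"
  assumes A: "topological_group A S" and G: "comm_group G" and ex: "short_exact A G C f h"
begin

sublocale A: group A using A by (simp add: topological_group_def)
sublocale G: comm_group G by (fact G)

abbreviation strict_group_topology :: "'b topology \<Rightarrow> bool" where
  "strict_group_topology T \<equiv> topological_group G T \<and>
     strictly_short_exact A S G T C (discrete_topology (carrier C)) f h"

lemma topspace_S: "topspace S = carrier A"
  using A by (simp add: topological_group_def)

lemma f_hom: "group_hom A G f"
  using ex by unfold_locales (simp add: short_exact_def)

lemmas f_simps [simp] = group_hom.hom_closed[OF f_hom] group_hom.hom_mult[OF f_hom]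
  group_hom.hom_one[OF f_hom] group_hom.hom_inv[OF f_hom]

lemma f_eq_iff: "a \<in> carrier A \<Longrightarrow> b \<in> carrier A \<Longrightarrow> f a = f b \<longleftrightarrow> a = b"
  using ex by (auto simp: short_exact_def inj_on_def)

lemma image_f: "f ` carrier A = {x \<in> carrier G. h x = \<one>\<^bsub>C\<^esub>}"
  using ex by (simp add: short_exact_def kernel_def)

text \<open>\<open>C\<close> is a bare monoid record without group laws. That its unit is right
  neutral on values of \<open>h\<close> is read off from \<open>h\<close> itself, which is
  multiplicative and sends the unit of G, being \<open>f\<close> of the unit of A, to the unit of
  C.\<close>

lemma h_mult_f: "x \<in> carrier G \<Longrightarrow> a \<in> carrier A \<Longrightarrow> h (x \<otimes>\<^bsub>G\<^esub> f a) = h x"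
proof -
  assume x: "x \<in> carrier G" and a: "a \<in> carrier A"
  have mult: "h (y \<otimes>\<^bsub>G\<^esub> z) = h y \<otimes>\<^bsub>C\<^esub> h z" if "y \<in> carrier G" "z \<in> carrier G" for y z
    using ex that by (simp add: short_exact_def hom_def)
  have "h (f a) = \<one>\<^bsub>C\<^esub>" "h \<one>\<^bsub>G\<^esub> = \<one>\<^bsub>C\<^esub>"
    using image_f a f_simps(3) A.one_closed by (metis (mono_tags, lifting) image_eqI mem_Collect_eq)+
  then show ?thesis
    using mult[OF x f_simps(1)[OF a]] mult[OF x G.one_closed] x by simp
qed

text \<open>This is the final topology for the maps a \<mapsto> x f(a): every coset of the image of
  \<open>f\<close> is open and carries the topology of A. All x in G occur instead of coset
  representatives, which avoids a choice; different x in one coset give the same condition because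
  translations of A are continuous.\<close>

lemma openin_extension_top:
  "openin (extension_top A S G f) W \<longleftrightarrow> W \<subseteq> carrier G \<and>
     (\<forall>x\<in>carrier G. openin S {a \<in> carrier A. x \<otimes>\<^bsub>G\<^esub> f a \<in> W})"
  unfolding extension_top_def
proof (rule openin_topology_iff)
  have "{a \<in> carrier A. x \<otimes>\<^bsub>G\<^esub> f a \<in> V \<inter> W} =
      {a \<in> carrier A. x \<otimes>\<^bsub>G\<^esub> f a \<in> V} \<inter> {a \<in> carrier A. x \<otimes>\<^bsub>G\<^esub> f a \<in> W}" for x V W
    by blast
  moreover have "{a \<in> carrier A. x \<otimes>\<^bsub>G\<^esub> f a \<in> \<Union>\<K>} =
      (\<Union>W\<in>\<K>. {a \<in> carrier A. x \<otimes>\<^bsub>G\<^esub> f a \<in> W})" for x \<K>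
    by blast
  ultimately show "istopology (\<lambda>W. W \<subseteq> carrier G \<and>
      (\<forall>x\<in>carrier G. openin S {a \<in> carrier A. x \<otimes>\<^bsub>G\<^esub> f a \<in> W}))"
    unfolding istopology_def by (auto simp: openin_clauses)
qed

lemma topspace_extension_top: "topspace (extension_top A S G f) = carrier G"
proof -
  have "{a \<in> carrier A. x \<otimes>\<^bsub>G\<^esub> f a \<in> carrier G} = topspace S" if "x \<in> carrier G" for x
    using that by (auto simp: topspace_S)
  then have "openin (extension_top A S G f) (carrier G)"
    by (simp add: openin_extension_top)
  then show ?thesis
    by (metis openin_extension_top openin_subset openin_topspace subset_antisym)
qed

text \<open>Pulling x f(N) back along a \<mapsto> z f(a) gives a left translate of N if z lies in
  the coset of x, and the empty set if not, cosets being disjoint.\<close>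

lemma open_translate_image:
  assumes N: "openin S N" and x: "x \<in> carrier G"
  shows "openin (extension_top A S G f) ((\<lambda>a. x \<otimes>\<^bsub>G\<^esub> f a) ` N)"
proof -
  have sub: "N \<subseteq> carrier A"
    using openin_subset[OF N] by (simp add: topspace_S)
  have "openin S {a \<in> carrier A. z \<otimes>\<^bsub>G\<^esub> f a \<in> (\<lambda>a. x \<otimes>\<^bsub>G\<^esub> f a) ` N}" (is "openin S ?P")
    if z: "z \<in> carrier G" for z
  proof (cases "\<exists>b\<in>carrier A. z = x \<otimes>\<^bsub>G\<^esub> f b")
    case True
    then obtain b where b: "b \<in> carrier A" "z = x \<otimes>\<^bsub>G\<^esub> f b" by blast
    have "z \<otimes>\<^bsub>G\<^esub> f a \<in> (\<lambda>a. x \<otimes>\<^bsub>G\<^esub> f a) ` N \<longleftrightarrow> b \<otimes>\<^bsub>A\<^esub> a \<in> N" if a: "a \<in> carrier A" for a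
    proof -
      have "z \<otimes>\<^bsub>G\<^esub> f a = x \<otimes>\<^bsub>G\<^esub> f (b \<otimes>\<^bsub>A\<^esub> a)"
        using a b x by (simp add: G.m_assoc)
      moreover have "x \<otimes>\<^bsub>G\<^esub> f (b \<otimes>\<^bsub>A\<^esub> a) = x \<otimes>\<^bsub>G\<^esub> f c \<longleftrightarrow> b \<otimes>\<^bsub>A\<^esub> a = c" if "c \<in> carrier A" for c
        using a b x that f_eq_iff[of "b \<otimes>\<^bsub>A\<^esub> a" c] by (auto simp del: f_simps(2))
      ultimately show ?thesis
        using sub by (auto simp del: f_simps(2))
    qed
    then have "?P = {a \<in> topspace S. b \<otimes>\<^bsub>A\<^esub> a \<in> N}"
      by (auto simp: topspace_S)
    then show ?thesis
      using openin_continuous_map_preimage[OF topological_group_translation[OF A b(1)] N] by simp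
  next
    case False
    have "?P = {}"
    proof (rule ccontr)
      assume "?P \<noteq> {}"
      then obtain a n where an: "a \<in> carrier A" "n \<in> carrier A" "z \<otimes>\<^bsub>G\<^esub> f a = x \<otimes>\<^bsub>G\<^esub> f n"
        using sub by blast
      then have "z = x \<otimes>\<^bsub>G\<^esub> f n \<otimes>\<^bsub>G\<^esub> inv\<^bsub>G\<^esub> f a"
        using x z by (metis G.inv_solve_right f_simps(1) G.m_closed)
      then have "z = x \<otimes>\<^bsub>G\<^esub> f (n \<otimes>\<^bsub>A\<^esub> inv\<^bsub>A\<^esub> a)"
        using an x by (simp add: G.m_assoc)
      then show False
        using False an by blast
    qed
    then show ?thesis by (metis openin_empty)
  qed
  then show ?thesis
    unfolding openin_extension_top using sub x by auto
qed

text \<open>Around x and y the sets x f(N1) and y f(N2) are open, and by commutativity their product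
  is (x y) f(N1 N2); so continuity at (x, y) reduces to continuity of the multiplication of A at the
  unit. Likewise the inverse of x f(a) is the inverse of x times f of the inverse of a, which
  reduces inversion to that of A.\<close>

lemma topological_group_extension: "topological_group G (extension_top A S G f)"
proof -
  let ?T = "extension_top A S G f"
  note top = topspace_extension_top
  have one: "\<one>\<^bsub>A\<^esub> \<in> carrier A" by simp
  have "continuous_map (prod_topology ?T ?T) ?T (\<lambda>(x, y). x \<otimes>\<^bsub>G\<^esub> y)"
    unfolding continuous_map_def
  proof (intro conjI allI impI)
    fix W assume W: "openin ?T W"
    let ?P = "{z \<in> topspace (prod_topology ?T ?T). (\<lambda>(x, y). x \<otimes>\<^bsub>G\<^esub> y) z \<in> W}"
    show "openin (prod_topology ?T ?T) ?P"
      unfolding openin_prod_topology_alt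
    proof (intro allI impI)
      fix x y assume "(x, y) \<in> ?P"
      then have x: "x \<in> carrier G" and y: "y \<in> carrier G" and xy: "x \<otimes>\<^bsub>G\<^esub> y \<in> W"
        by (auto simp: top)
      let ?N = "{a \<in> carrier A. (x \<otimes>\<^bsub>G\<^esub> y) \<otimes>\<^bsub>G\<^esub> f a \<in> W}"
      let ?M = "{z \<in> topspace (prod_topology S S). (\<lambda>(a, b). a \<otimes>\<^bsub>A\<^esub> b) z \<in> ?N}"
      have "openin S ?N"
        using W x y unfolding openin_extension_top by simp
      moreover have "continuous_map (prod_topology S S) S (\<lambda>(a, b). a \<otimes>\<^bsub>A\<^esub> b)"
        using A by (simp add: topological_group_def)
      ultimately have "openin (prod_topology S S) ?M"
        by (rule openin_continuous_map_preimage[rotated])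
      moreover have "(\<one>\<^bsub>A\<^esub>, \<one>\<^bsub>A\<^esub>) \<in> ?M"
        using x y xy by (simp add: topspace_S)
      ultimately obtain N1 N2 where N: "openin S N1" "openin S N2" "\<one>\<^bsub>A\<^esub> \<in> N1" "\<one>\<^bsub>A\<^esub> \<in> N2"
        "N1 \<times> N2 \<subseteq> ?M"
        unfolding openin_prod_topology_alt by meson
      let ?U = "(\<lambda>a. x \<otimes>\<^bsub>G\<^esub> f a) ` N1" and ?V = "(\<lambda>a. y \<otimes>\<^bsub>G\<^esub> f a) ` N2"
      have sub: "N1 \<subseteq> carrier A" "N2 \<subseteq> carrier A"
        using N openin_subset topspace_S by blast+
      have "openin ?T ?U" "openin ?T ?V"
        using open_translate_image N x y by blast+
      moreover have "x \<in> ?U" "y \<in> ?V"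
        using N(3,4) x y by (force intro: image_eqI[of _ _ "\<one>\<^bsub>A\<^esub>"])+
      moreover have "?U \<times> ?V \<subseteq> ?P"
      proof -
        have "x \<otimes>\<^bsub>G\<^esub> f a \<otimes>\<^bsub>G\<^esub> (y \<otimes>\<^bsub>G\<^esub> f b) \<in> W" if "a \<in> N1" "b \<in> N2" for a b
        proof -
          have "x \<otimes>\<^bsub>G\<^esub> f a \<otimes>\<^bsub>G\<^esub> (y \<otimes>\<^bsub>G\<^esub> f b) = (x \<otimes>\<^bsub>G\<^esub> y) \<otimes>\<^bsub>G\<^esub> f (a \<otimes>\<^bsub>A\<^esub> b)"
            using that sub x y by (simp add: subset_iff G.m_ac)
          then show ?thesis
            using N(5) that by auto
        qed
        then show ?thesis
          using sub x y by (auto simp: top subset_iff)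
      qed
      ultimately show "\<exists>U V. openin ?T U \<and> openin ?T V \<and> x \<in> U \<and> y \<in> V \<and> U \<times> V \<subseteq> ?P"
        by blast
    qed
  qed (auto simp: top)
  moreover have "continuous_map ?T ?T (\<lambda>x. inv\<^bsub>G\<^esub> x)"
    unfolding continuous_map_def
  proof (intro conjI allI impI)
    fix W assume W: "openin ?T W"
    have "openin S {a \<in> carrier A. x \<otimes>\<^bsub>G\<^esub> f a \<in> {x \<in> topspace ?T. inv\<^bsub>G\<^esub> x \<in> W}}"
      if x: "x \<in> carrier G" for x
    proof -
      let ?N = "{a \<in> carrier A. inv\<^bsub>G\<^esub> x \<otimes>\<^bsub>G\<^esub> f a \<in> W}"
      have "openin S ?N"
        using W x unfolding openin_extension_top by simp
      moreover have "continuous_map S S (\<lambda>a. inv\<^bsub>A\<^esub> a)"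
        using A by (simp add: topological_group_def)
      ultimately have "openin S {a \<in> topspace S. inv\<^bsub>A\<^esub> a \<in> ?N}"
        by (rule openin_continuous_map_preimage[rotated])
      moreover have "{a \<in> carrier A. x \<otimes>\<^bsub>G\<^esub> f a \<in> {x \<in> topspace ?T. inv\<^bsub>G\<^esub> x \<in> W}} =
          {a \<in> topspace S. inv\<^bsub>A\<^esub> a \<in> ?N}"
        using x by (auto simp: top topspace_S G.inv_mult)
      ultimately show ?thesis by simp
    qed
    then show "openin ?T {x \<in> topspace ?T. inv\<^bsub>G\<^esub> x \<in> W}"
      by (auto simp: openin_extension_top top)
  qed (auto simp: top)
  ultimately show ?thesis
    by (simp add: topological_group_def top G.is_group)
qed

text \<open>The image f(N) is the translate of N by the unit of G, hence open. Since
  \<open>h\<close> is constant on the cosets of the image of \<open>f\<close>, the preimage of any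
  set under \<open>h\<close> contains each coset or misses it, and is therefore open.\<close>

lemma strict_extension: "strict_group_topology (extension_top A S G f)"
proof -
  let ?T = "extension_top A S G f"
  note top = topspace_extension_top
  have h: "h \<in> carrier G \<rightarrow> carrier C"
    using ex by (auto simp: short_exact_def hom_def)
  have "continuous_map S ?T f"
    unfolding continuous_map_def
  proof (intro conjI allI impI)
    fix W assume "openin ?T W"
    then have "openin S {a \<in> carrier A. \<one>\<^bsub>G\<^esub> \<otimes>\<^bsub>G\<^esub> f a \<in> W}"
      unfolding openin_extension_top by blast
    moreover have "{a \<in> carrier A. \<one>\<^bsub>G\<^esub> \<otimes>\<^bsub>G\<^esub> f a \<in> W} = {a \<in> topspace S. f a \<in> W}"
      by (auto simp: topspace_S)
    ultimately show "openin S {a \<in> topspace S. f a \<in> W}" by simp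
  qed (auto simp: top topspace_S)
  moreover have "open_map S (subtopology ?T (f ` topspace S)) f"
    unfolding open_map_def
  proof (intro allI impI)
    fix N assume N: "openin S N"
    then have sub: "N \<subseteq> carrier A"
      using openin_subset topspace_S by blast
    have "(\<lambda>a. \<one>\<^bsub>G\<^esub> \<otimes>\<^bsub>G\<^esub> f a) ` N = f ` N"
      using sub by (intro image_cong) auto
    then have "openin ?T (f ` N)"
      using open_translate_image[OF N G.one_closed] by simp
    then show "openin (subtopology ?T (f ` topspace S)) (f ` N)"
      using sub topspace_S by (auto simp: openin_subtopology)
  qed
  moreover have "continuous_map ?T (discrete_topology (carrier C)) h"
    unfolding continuous_map_def
  proof (intro conjI allI impI)
    fix W
    have "openin S {a \<in> carrier A. x \<otimes>\<^bsub>G\<^esub> f a \<in> {x \<in> carrier G. h x \<in> W}}"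
      if x: "x \<in> carrier G" for x
    proof -
      have "{a \<in> carrier A. x \<otimes>\<^bsub>G\<^esub> f a \<in> {x \<in> carrier G. h x \<in> W}} = (if h x \<in> W then topspace S else {})"
        using x by (auto simp: h_mult_f topspace_S)
      then show ?thesis by simp
    qed
    then show "openin ?T {x \<in> topspace ?T. h x \<in> W}"
      by (auto simp: openin_extension_top top)
  qed (use h in \<open>auto simp: top\<close>)
  moreover have "open_map ?T (subtopology (discrete_topology (carrier C)) (h ` topspace ?T)) h"
    unfolding open_map_def using h openin_subset[of ?T] by (fastforce simp: top subtopology_discrete_topology)
  ultimately show ?thesis
    using topological_group_extension ex by (simp add: strictly_short_exact_def strict_map_def)
qed

lemma clopen_image_f:
  assumes T: "strict_group_topology T"
  shows "openin T (f ` carrier A)" and "closedin T (f ` carrier A)"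
proof -
  have h: "continuous_map T (discrete_topology (carrier C)) h" and top: "topspace T = carrier G"
    using T by (auto simp: strictly_short_exact_def strict_map_def topological_group_def)
  \<comment> \<open>The unit of C is known to lie in the carrier only as the value of
    \<open>h\<close> at the unit of G.\<close>
  have one: "\<one>\<^bsub>C\<^esub> \<in> carrier C"
    using image_f h f_simps(3) A.one_closed top unfolding continuous_map_def
    by (metis (mono_tags, lifting) PiE G.one_closed image_eqI mem_Collect_eq topspace_discrete_topology)
  have eq: "f ` carrier A = {x \<in> topspace T. h x \<in> {\<one>\<^bsub>C\<^esub>}}"
    by (simp add: image_f top)
  show "openin T (f ` carrier A)"
    unfolding eq using one by (intro openin_continuous_map_preimage[OF h]) simp
  show "closedin T (f ` carrier A)"
    unfolding eq using one by (intro closedin_continuous_map_preimage[OF h]) simp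
qed

text \<open>Continuity of \<open>f\<close> and of the translations makes every set open in T open in
  \<open>extension_top\<close>. For the converse, strictness gives openness of \<open>f\<close>
  relative to its image only; as the image is open in T, this is openness in T, and translates of
  such sets fill out W.\<close>

lemma strict_topology_unique:
  assumes T: "strict_group_topology T"
  shows "T = extension_top A S G f"
  unfolding topology_eq openin_extension_top
proof (intro allI iffI)
  fix W assume W: "openin T W"
  have top: "topspace T = carrier G" and f: "continuous_map S T f"
    using T by (auto simp: strictly_short_exact_def strict_map_def topological_group_def)
  have "openin S {a \<in> carrier A. x \<otimes>\<^bsub>G\<^esub> f a \<in> W}" if "x \<in> carrier G" for x
    using openin_continuous_map_preimage[OF continuous_map_compose[OF f
      topological_group_translation[OF conjunct1[OF T] that]] W] by (simp add: topspace_S o_def)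
  then show "W \<subseteq> carrier G \<and> (\<forall>x\<in>carrier G. openin S {a \<in> carrier A. x \<otimes>\<^bsub>G\<^esub> f a \<in> W})"
    using openin_subset[OF W] top by simp
next
  fix W assume W: "W \<subseteq> carrier G \<and> (\<forall>x\<in>carrier G. openin S {a \<in> carrier A. x \<otimes>\<^bsub>G\<^esub> f a \<in> W})"
  show "openin T W"
  proof (subst openin_subopen, intro ballI)
    fix x assume x: "x \<in> W"
    then have xG: "x \<in> carrier G" using W by blast
    let ?N = "{a \<in> carrier A. x \<otimes>\<^bsub>G\<^esub> f a \<in> W}"
    have "openin (subtopology T (f ` topspace S)) (f ` ?N)"
      using T W xG by (auto simp: strictly_short_exact_def strict_map_def open_map_def)
    then have "openin T (f ` ?N)"
      using clopen_image_f(1)[OF T] openin_trans_full topspace_S by metis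
    then have "openin T ((\<lambda>y. x \<otimes>\<^bsub>G\<^esub> y) ` f ` ?N)"
      by (rule topological_group_translate_open[OF conjunct1[OF T] xG])
    moreover have "x \<in> (\<lambda>y. x \<otimes>\<^bsub>G\<^esub> y) ` f ` ?N"
      unfolding image_image using x xG by (intro image_eqI[of _ _ "\<one>\<^bsub>A\<^esub>"]) auto
    ultimately show "\<exists>U. openin T U \<and> x \<in> U \<and> U \<subseteq> W"
      by blast
  qed
qed

lemma identity_component:
  assumes T: "strict_group_topology T" and S: "connected_space S"
  shows "connected_component_of_set T \<one>\<^bsub>G\<^esub> = f ` carrier A"
proof (rule connected_component_of_unique)
  show one: "\<one>\<^bsub>G\<^esub> \<in> f ` carrier A"
    using f_simps(3) A.one_closed by (metis imageI)
  have "continuous_map S T f"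
    using T by (simp add: strictly_short_exact_def strict_map_def)
  then show "connectedin T (f ` carrier A)"
    using S connectedin_continuous_map_image topspace_S connectedin_topspace by metis
  fix C' assume C': "\<one>\<^bsub>G\<^esub> \<in> C' \<and> connectedin T C'"
  then have "C' \<subseteq> f ` carrier A \<or> disjnt C' (f ` carrier A)"
    using connectedin_clopen_cases clopen_image_f[OF T] by metis
  then show "C' \<subseteq> f ` carrier A"
    using C' one by (auto simp: disjnt_def)
qed

end


section \<open>Smooth functions on the quadrant\<close>

lemma openin_Euclidean_space_iff:
  "openin (Euclidean_space n) U \<longleftrightarrow> (\<exists>W. open W \<and> U = W \<inter> {x. \<forall>i\<ge>n. x i = 0})"
  by (simp add: Euclidean_space_def euclidean_product_topology openin_subtopology)

lemma openin_corner_space_iff: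
  "openin (corner_space n) V \<longleftrightarrow>
     (\<exists>W. open W \<and> V = W \<inter> {x. (\<forall>i\<ge>n. x i = 0) \<and> (\<forall>i<n. 0 \<le> x i)})"
proof -
  have "corner_space n =
      subtopology euclidean {x. (\<forall>i\<ge>n. x i = 0) \<and> (\<forall>i<n. 0 \<le> x i)}"
    by (simp add: corner_space_def Euclidean_space_def euclidean_product_topology
        subtopology_subtopology Collect_conj_eq)
  then show ?thesis
    by (simp add: openin_subtopology)
qed

lemma Ck_on_subset: "Ck_on k n U F \<Longrightarrow> V \<subseteq> U \<Longrightarrow> Ck_on k n V F"
proof (induction k arbitrary: F)
  case 0
  then show ?case by (auto intro: continuous_on_subset)
next
  case (Suc k)
  then show ?case
    using continuous_on_subset[of U F V] by simp (meson subsetD)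
qed

lemma Ck_on_lincomb:
  fixes F G :: "(nat \<Rightarrow> real) \<Rightarrow> real"
  assumes "Ck_on k n U F" and "Ck_on k n U G"
  shows "Ck_on k n U (\<lambda>x. a * F x + b * G x)"
  using assms
proof (induction k arbitrary: F G)
  case 0
  then show ?case by (auto intro!: continuous_intros)
next
  case (Suc k)
  have "\<exists>H. (\<forall>x\<in>U. ((\<lambda>t. a * F (x(i := t)) + b * G (x(i := t))) has_vector_derivative H x) (at (x i))) \<and>
      Ck_on k n U H" if i: "i < n" for i
  proof -
    obtain F' where
      "\<forall>x\<in>U. ((\<lambda>t. F (x(i := t))) has_vector_derivative F' x) (at (x i))" "Ck_on k n U F'"
      using Suc.prems(1) i unfolding Ck_on.simps by blast
    moreover obtain G' where
      "\<forall>x\<in>U. ((\<lambda>t. G (x(i := t))) has_vector_derivative G' x) (at (x i))" "Ck_on k n U G'"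
      using Suc.prems(2) i unfolding Ck_on.simps by blast
    ultimately show ?thesis
      by (intro exI[of _ "\<lambda>x. a * F' x + b * G' x"] conjI ballI Suc.IH)
        (auto intro!: has_vector_derivative_add has_vector_derivative_mult_right)
  qed
  then show ?case
    using Suc.prems by (auto intro!: continuous_intros)
qed

lemma Ck_on_zero: "Ck_on k n U (\<lambda>x. 0 :: real)"
  by (induction k) (auto intro!: exI[of _ "\<lambda>x. 0 :: real"])

lemma smooth_on_lincomb:
  fixes f g :: "(nat \<Rightarrow> real) \<Rightarrow> real"
  assumes f: "smooth_on n W f" and g: "smooth_on n W g"
  shows "smooth_on n W (\<lambda>x. a * f x + b * g x)"
  unfolding smooth_on_def
proof
  fix x assume "x \<in> W"
  then obtain U F V G where
    "openin (Euclidean_space n) U" "x \<in> U" "\<forall>k. Ck_on k n U F" "\<forall>y\<in>U \<inter> W. F y = f y"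
    "openin (Euclidean_space n) V" "x \<in> V" "\<forall>k. Ck_on k n V G" "\<forall>y\<in>V \<inter> W. G y = g y"
    using f g unfolding smooth_on_def by metis
  then show "\<exists>U F. openin (Euclidean_space n) U \<and> x \<in> U \<and> (\<forall>k. Ck_on k n U F) \<and>
      (\<forall>y\<in>U \<inter> W. F y = a * f y + b * g y)"
    by (intro exI[of _ "U \<inter> V"] exI[of _ "\<lambda>x. a * F x + b * G x"])
      (auto intro!: Ck_on_lincomb intro: Ck_on_subset)
qed

text \<open>Even for a constant function \<open>smooth_on\<close> asks for a neighbourhood of each
  point in the space of sequences vanishing from n on. Openness in the quadrant ensures that W lies
  in that space.\<close>

lemma smooth_on_zero:
  assumes "openin (corner_space n) W"
  shows "smooth_on n W (\<lambda>x. 0 :: real)"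
proof -
  have "openin (Euclidean_space n) {x. \<forall>i\<ge>n. x i = 0}"
    unfolding openin_Euclidean_space_iff by (intro exI[of _ UNIV]) auto
  moreover have "W \<subseteq> {x. \<forall>i\<ge>n. x i = 0}"
    using assms by (auto simp: openin_corner_space_iff)
  ultimately show ?thesis
    unfolding smooth_on_def
    by (intro ballI exI[of _ "{x. \<forall>i\<ge>n. x i = 0}"] exI[of _ "\<lambda>x. 0 :: real"]) (auto simp: Ck_on_zero)
qed

lemma continuous_on_smooth_on:
  assumes "openin (corner_space n) W" and f: "smooth_on n W f"
  shows "continuous_on W f"
  unfolding continuous_on_eq_continuous_within
proof
  fix x assume x: "x \<in> W"
  have W: "W \<subseteq> {x. \<forall>i\<ge>n. x i = 0}"
    using assms by (auto simp: openin_corner_space_iff)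
  obtain U F where U: "openin (Euclidean_space n) U" "x \<in> U" "\<forall>k. Ck_on k n U F" "\<forall>y\<in>U \<inter> W. F y = f y"
    using f x unfolding smooth_on_def by metis
  obtain Z where Z: "open Z" "U = Z \<inter> {x. \<forall>i\<ge>n. x i = 0}"
    using U(1) by (auto simp: openin_Euclidean_space_iff)
  have "continuous_on U F"
    using U(3) by (metis Ck_on.simps(1))
  then have "continuous_on (U \<inter> W) f"
    using U(4) continuous_on_subset by (metis (mono_tags, lifting) continuous_on_cong inf_le1)
  then have "continuous (at x within U \<inter> W) f"
    using x U(2) by (simp add: continuous_on_eq_continuous_within)
  \<comment> \<open>As W lies in the n-dimensional space, \<open>U \<inter> W\<close> is
    \<open>Z \<inter> W\<close> with Z open, so passing to it does not change limits at x.\<close>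
  moreover have "at x within U \<inter> W = at x within W"
    using Z x U(2) W by (intro at_within_nhd[of x Z]) auto
  ultimately show "continuous (at x within W) f"
    by simp
qed

lemma open_slice:
  fixes x :: "nat \<Rightarrow> real"
  assumes "open Z"
  shows "open {t. x(i := t) \<in> Z}"
proof -
  have "continuous_on UNIV (\<lambda>t. x(i := t))"
  proof (intro continuous_on_coordinatewise_then_product)
    fix j
    show "continuous_on UNIV (\<lambda>t. (x(i := t)) j)"
      by (cases "j = i") auto
  qed
  then have "open ((\<lambda>t. x(i := t)) -` Z)"
    using assms by (intro open_vimage)
  then show ?thesis
    by (simp add: vimage_def)
qed

text \<open>On the boundary x i may be 0, with nothing of the slice to its left; a short interval to
  the right always stays in V, because increasing a coordinate does not leave the quadrant.
  Nontriviality of this filter is what makes the one-sided derivative unique.\<close>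

lemma slice_not_isolated:
  assumes "openin (corner_space n) V" and "x \<in> V" and "i < n"
  shows "at (x i) within {t. x(i := t) \<in> V} \<noteq> bot"
proof -
  obtain Z where Z: "open Z" "V = Z \<inter> {x. (\<forall>i\<ge>n. x i = 0) \<and> (\<forall>i<n. 0 \<le> x i)}"
    using assms(1) by (auto simp: openin_corner_space_iff)
  have "x i \<in> {t. x(i := t) \<in> Z}"
    using assms(2) Z by simp
  then obtain e where e: "0 < e" "ball (x i) e \<subseteq> {t. x(i := t) \<in> Z}"
    using open_slice[OF Z(1)] open_contains_ball by blast
  have "{x i<..<x i + e} \<subseteq> {t. x(i := t) \<in> V}"
  proof
    fix t assume t: "t \<in> {x i<..<x i + e}"
    then have "x(i := t) \<in> Z"
      using e by (auto simp: dist_real_def subset_iff)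
    moreover have "0 \<le> x i"
      using assms(2,3) Z by simp
    ultimately show "t \<in> {t. x(i := t) \<in> V}"
      using t assms(2,3) Z by auto
  qed
  moreover have "at (x i) within {x i<..<x i + e} \<noteq> bot"
    using e(1) islimpt_greaterThanLessThan1[of "x i" "x i + e"] by (simp add: trivial_limit_within)
  ultimately show ?thesis
    by (metis at_le bot.extremum_uniqueI)
qed

text \<open>Near x the function agrees with a C1 function on an open set of the n-dimensional space,
  whose two-sided derivative restricts to the slice.\<close>

lemma smooth_on_has_partial_derivative:
  assumes "openin (corner_space n) V" and h: "smooth_on n V h" and x: "x \<in> V" and i: "i < n"
  shows "\<exists>y. ((\<lambda>t. h (x(i := t))) has_vector_derivative y) (at (x i) within {t. x(i := t) \<in> V})"
proof -
  let ?S = "{t. x(i := t) \<in> V}"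
  have V: "V \<subseteq> {x. \<forall>i\<ge>n. x i = 0}"
    using assms by (auto simp: openin_corner_space_iff)
  obtain U F where U: "openin (Euclidean_space n) U" "x \<in> U" "\<forall>k. Ck_on k n U F" "\<forall>y\<in>U \<inter> V. F y = h y"
    using h x unfolding smooth_on_def by metis
  obtain Z where Z: "open Z" "U = Z \<inter> {x. \<forall>i\<ge>n. x i = 0}"
    using U(1) by (auto simp: openin_Euclidean_space_iff)
  let ?N = "{t. x(i := t) \<in> Z}"
  have "Ck_on (Suc 0) n U F"
    using U(3) by blast
  then obtain y where "((\<lambda>t. F (x(i := t))) has_vector_derivative y) (at (x i))"
    using i U(2) by auto
  then have F: "((\<lambda>t. F (x(i := t))) has_vector_derivative y) (at (x i) within ?N \<inter> ?S)"
    by (rule has_vector_derivative_at_within)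
  have "x i \<in> ?N \<inter> ?S"
    using x U(2) Z(2) by simp
  moreover have "h (x(i := t)) = F (x(i := t))" if "t \<in> ?N \<inter> ?S" for t
    using U(4) Z(2) V that by auto
  ultimately have "((\<lambda>t. h (x(i := t))) has_vector_derivative y) (at (x i) within ?N \<inter> ?S)"
    using F by (rule has_vector_derivative_transform)
  moreover have "at (x i) within ?N \<inter> ?S = at (x i) within ?S"
    using open_slice[OF Z(1)] U(2) Z(2) by (intro at_within_nhd[of _ ?N]) auto
  ultimately show ?thesis
    by auto
qed

lemma openin_chart_image:
  "compact_mfd M \<Longrightarrow> c \<in> atlas M \<Longrightarrow> openin (corner_space (mdim M)) (snd c ` fst c)"
  by (simp add: compact_mfd_def)

text \<open>\<open>pderiv_chart\<close> selects a derivative by choice, so it respects linear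
  combinations only where derivatives exist and are unique; the two facts on slices supply
  this.\<close>

lemma pderiv_chart_lincomb:
  fixes h k :: "'p \<Rightarrow> real"
  assumes M: "compact_mfd M" and c: "c \<in> atlas M" and p: "p \<in> fst c" and i: "i < mdim M"
    and h: "smooth_on (mdim M) (snd c ` fst c) (\<lambda>x. h (cinv c x))"
    and k: "smooth_on (mdim M) (snd c ` fst c) (\<lambda>x. k (cinv c x))"
  shows "pderiv_chart c i (\<lambda>q. a * h q + b * k q) p = a * pderiv_chart c i h p + b * pderiv_chart c i k p"
proof -
  note V = openin_chart_image[OF M c]
  have p': "snd c p \<in> snd c ` fst c"
    using p by simp
  let ?F = "at (snd c p i) within {t. (snd c p)(i := t) \<in> snd c ` fst c}"
  obtain y z where
    y: "((\<lambda>t. h (cinv c ((snd c p)(i := t)))) has_vector_derivative y) ?F" and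
    z: "((\<lambda>t. k (cinv c ((snd c p)(i := t)))) has_vector_derivative z) ?F"
    using smooth_on_has_partial_derivative[OF V h p' i] smooth_on_has_partial_derivative[OF V k p' i]
    by blast
  have yz: "((\<lambda>t. a * h (cinv c ((snd c p)(i := t))) + b * k (cinv c ((snd c p)(i := t))))
      has_vector_derivative a * y + b * z) ?F"
    using y z by (intro has_vector_derivative_add has_vector_derivative_mult_right)
  note vd = vector_derivative_within[OF slice_not_isolated[OF V p' i]]
  show ?thesis
    unfolding pderiv_chart_def vd[OF y] vd[OF z] vd[OF yz] ..
qed


section \<open>Linear structure on tensor fields and forms\<close>

text \<open>Sums, differences and inverses of forms are all instances, with
  \<open>f_lin (-1) S 0 S\<close> for the inverse and two coefficients 0 for \<open>f_zero\<close>,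
  so that each operation on forms has a single linearity statement.\<close>

definition f_lin :: "real \<Rightarrow> 'p field \<Rightarrow> real \<Rightarrow> 'p field \<Rightarrow> 'p field" where
  "f_lin a S b T = (\<lambda>c I p. a * S c I p + b * T c I p)"

lemma f_lin_apply: "f_lin a S b T c I p = a * S c I p + b * T c I p"
  by (simp add: f_lin_def)

lemma f_add_eq_lin: "f_add S T = f_lin 1 S 1 T"
  by (simp add: f_add_def f_lin_def)

lemma f_diff_eq_lin: "f_diff S T = f_lin 1 S (-1) T"
  by (simp add: f_diff_def f_lin_def)

lemma f_lin_zero [simp]: "f_lin a f_zero b f_zero = f_zero" "f_lin 0 S 0 T = f_zero"
  by (simp_all add: f_lin_def)

lemma pull_comp_lin:
  "pull_comp m c c' f (f_lin a S b T) I p = a * pull_comp m c c' f S I p + b * pull_comp m c c' f T I p"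
  unfolding pull_comp_def f_lin_def sum_distrib_left sum.distrib[symmetric]
  by (intro sum.cong refl) (simp add: distrib_left)

lemma cov_field_transform:
  "cov_field M T \<Longrightarrow> c \<in> atlas M \<Longrightarrow> c' \<in> atlas M \<Longrightarrow> p \<in> fst c \<Longrightarrow> p \<in> fst c' \<Longrightarrow>
    set I \<subseteq> {..<mdim M} \<Longrightarrow> T c I p = pull_comp (mdim M) c c' (\<lambda>q. q) T I p"
  unfolding cov_field_def by blast

lemma cov_field_support:
  "cov_field M T \<Longrightarrow> \<not> (c \<in> atlas M \<and> p \<in> fst c \<and> set I \<subseteq> {..<mdim M}) \<Longrightarrow> T c I p = 0"
  unfolding cov_field_def by meson

lemma cov_field_smooth:
  "cov_field M T \<Longrightarrow> c \<in> atlas M \<Longrightarrow> smooth_on (mdim M) (snd c ` fst c) (\<lambda>x. T c I (cinv c x))"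
  unfolding cov_field_def by meson

lemma cov_field_lin:
  assumes "cov_field M S" and "cov_field M T"
  shows "cov_field M (f_lin a S b T)"
  unfolding cov_field_def
proof (intro conjI allI ballI impI)
  fix c c' I p
  assume "c \<in> atlas M" "c' \<in> atlas M" "p \<in> fst c \<inter> fst c'" "set I \<subseteq> {..<mdim M}"
  then show "f_lin a S b T c I p = pull_comp (mdim M) c c' (\<lambda>q. q) (f_lin a S b T) I p"
    unfolding pull_comp_lin unfolding f_lin_def using assms by (simp add: cov_field_transform[of M _ c c'])
next
  fix c I p assume "\<not> (c \<in> atlas M \<and> p \<in> fst c \<and> set I \<subseteq> {..<mdim M})"
  then show "f_lin a S b T c I p = 0"
    using assms by (simp add: f_lin_def cov_field_support)
next
  fix c I assume "c \<in> atlas M"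
  then show "smooth_on (mdim M) (snd c ` fst c) (\<lambda>x. f_lin a S b T c I (cinv c x))"
    unfolding f_lin_def using assms by (intro smooth_on_lincomb cov_field_smooth)
qed

lemma cov_field_zero:
  assumes "compact_mfd M"
  shows "cov_field M f_zero"
  using assms by (auto simp: cov_field_def pull_comp_def openin_chart_image smooth_on_zero)

text \<open>The transformation law relates I only to lists J of the same length, so it holds in
  every degree separately.\<close>

lemma cov_field_degree_part:
  assumes "cov_field M T" and "compact_mfd M"
  shows "cov_field M (degree_part k T)"
  unfolding cov_field_def
proof (intro conjI allI ballI impI)
  fix c c' I p
  assume "c \<in> atlas M" "c' \<in> atlas M" "p \<in> fst c \<inter> fst c'" "set I \<subseteq> {..<mdim M}"
  then have "T c I p = pull_comp (mdim M) c c' (\<lambda>q. q) T I p"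
    using assms(1) by (intro cov_field_transform) auto
  then show "degree_part k T c I p = pull_comp (mdim M) c c' (\<lambda>q. q) (degree_part k T) I p"
    by (auto simp: degree_part_def pull_comp_def index_lists_def intro!: sum.cong sum.neutral[symmetric])
next
  fix c I assume "c \<in> atlas M"
  then show "smooth_on (mdim M) (snd c ` fst c) (\<lambda>x. degree_part k T c I (cinv c x))"
    using assms cov_field_smooth[of M T c I]
    by (cases "length I = k") (simp_all add: degree_part_def smooth_on_zero openin_chart_image)
next
  fix c I p assume "\<not> (c \<in> atlas M \<and> p \<in> fst c \<and> set I \<subseteq> {..<mdim M})"
  then show "degree_part k T c I p = 0"
    using cov_field_support[OF assms(1)] by (simp add: degree_part_def)
qed

lemma degree_part_lin: "degree_part k (f_lin a S b T) = f_lin a (degree_part k S) b (degree_part k T)"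
  by (simp add: degree_part_def f_lin_def fun_eq_iff)

lemma Omega_lin:
  assumes "S \<in> Omega M P" and "T \<in> Omega M P"
  shows "f_lin a S b T \<in> Omega M P"
  using assms cov_field_lin[of M S T a b]
  by (auto simp: Omega_def diff_form_def) (simp_all add: f_lin_def algebra_simps)

lemma Omega_zero:
  assumes "compact_mfd M"
  shows "f_zero \<in> Omega M P"
  using cov_field_zero[OF assms] by (simp add: Omega_def diff_form_def)

lemma ext_d_lin:
  assumes M: "compact_mfd M" and S: "cov_field M S" and T: "cov_field M T"
  shows "ext_d M (f_lin a S b T) = f_lin a (ext_d M S) b (ext_d M T)"
proof (intro ext)
  fix c I p
  show "ext_d M (f_lin a S b T) c I p = f_lin a (ext_d M S) b (ext_d M T) c I p"
  proof (cases "c \<in> atlas M \<and> p \<in> fst c \<and> set I \<subseteq> {..<mdim M}")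
    case True
    have "pderiv_chart c (I ! k) (f_lin a S b T c J) p =
        a * pderiv_chart c (I ! k) (S c J) p + b * pderiv_chart c (I ! k) (T c J) p"
      if "k < length I" for k J
      unfolding f_lin_def using True that S T
      by (intro pderiv_chart_lincomb[OF M] cov_field_smooth) (auto simp: subset_iff)
    then have "(\<Sum>k<length I. (-1) ^ k * pderiv_chart c (I ! k) (f_lin a S b T c (take k I @ drop (Suc k) I)) p) =
        (\<Sum>k<length I. a * ((-1) ^ k * pderiv_chart c (I ! k) (S c (take k I @ drop (Suc k) I)) p) +
          b * ((-1) ^ k * pderiv_chart c (I ! k) (T c (take k I @ drop (Suc k) I)) p))"
      by (intro sum.cong refl) (simp add: distrib_left)
    then show ?thesis
      using True by (simp add: f_lin_apply ext_d_def sum_distrib_left sum.distrib)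
  qed (auto simp: ext_d_def f_lin_apply)
qed

lemma closed_forms_lin:
  assumes "compact_mfd M" and "S \<in> closed_forms M P" and "T \<in> closed_forms M P"
  shows "f_lin a S b T \<in> closed_forms M P"
proof -
  have "cov_field M S" "cov_field M T"
    using assms by (auto simp: closed_forms_def Omega_def diff_form_def)
  then show ?thesis
    using assms by (auto simp: closed_forms_def Omega_lin ext_d_lin)
qed

lemma closed_forms_zero:
  assumes "compact_mfd M"
  shows "f_zero \<in> closed_forms M P"
  \<comment> \<open>Linearity with both coefficients 0 shows that \<open>ext_d\<close> kills
    \<open>f_zero\<close>.\<close>
  using ext_d_lin[OF assms cov_field_zero[OF assms] cov_field_zero[OF assms], of 0 0]
  by (simp add: closed_forms_def Omega_zero[OF assms])

section \<open>Linearity of periods and the subgroup of forms with integer periods\<close>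

lemma form_pull_lin: "form_pull M N f (f_lin a S b T) = f_lin a (form_pull M N f S) b (form_pull M N f T)"
  by (simp add: form_pull_def fun_eq_iff pull_comp_lin) (simp add: f_lin_def)

lemma form_wedge_lin: "form_wedge (f_lin a S b T) \<eta> = f_lin a (form_wedge S \<eta>) b (form_wedge T \<eta>)"
  unfolding form_wedge_def f_lin_def wedge_def sum_distrib_left sum.distrib[symmetric]
  by (intro ext sum.cong refl) (simp add: algebra_simps)

text \<open>Both integrals use the same charts \<open>cs\<close> and functions \<open>u\<close>, and
  \<open>has_bochner_integral\<close> carries integrability along, so the contributions combine
  chart by chart.\<close>

lemma has_form_integral_lin:
  assumes "has_form_integral V m cs u S y" and "has_form_integral V m cs u T z"
  shows "has_form_integral V m cs u (f_lin a S b T) (a * y + b * z)"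
proof -
  let ?n = "mdim (sac_mfd V)"
  let ?F = "\<lambda>\<eta> k x. let y = (\<lambda>i. if i < ?n then x i else 0); p = cinv (cs k) y in
    if y \<in> snd (cs k) ` fst (cs k) then sac_orient V (cs k) p * u k p * \<eta> (cs k) [0..<?n] p else 0"
  obtain J L where
    J: "\<forall>k<m. has_bochner_integral (Pi\<^sub>M {..<?n} (\<lambda>_. lborel)) (?F S k) (J k)" "y = (\<Sum>k<m. J k)" and
    L: "\<forall>k<m. has_bochner_integral (Pi\<^sub>M {..<?n} (\<lambda>_. lborel)) (?F T k) (L k)" "z = (\<Sum>k<m. L k)"
    using assms unfolding has_form_integral_def Let_def by auto
  have lin: "?F (f_lin a S b T) k = (\<lambda>x. a * ?F S k x + b * ?F T k x)" for k
    by (auto simp: Let_def f_lin_def fun_eq_iff algebra_simps)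
  have "\<forall>k<m. has_bochner_integral (Pi\<^sub>M {..<?n} (\<lambda>_. lborel)) (?F (f_lin a S b T) k) (a * J k + b * L k)"
    unfolding lin using J L by (auto intro!: has_bochner_integral_add has_bochner_integral_mult_right)
  then show ?thesis
    unfolding has_form_integral_def Let_def using J(2) L(2)
    by (auto intro!: exI[of _ "\<lambda>k. a * J k + b * L k"] simp: sum.distrib sum_distrib_left)
qed

lemma has_form_integral_zero: "has_form_integral V m cs u f_zero 0"
  by (auto simp: has_form_integral_def Let_def has_bochner_integral_zero cong: if_cong intro!: exI[of _ "\<lambda>k. 0"])

text \<open>Over a fixed cycle the period is linear in the form, the Todd form being a fixed second
  factor of the wedge product. Integer coefficients thus preserve integrality; (1, 1) gives closure
  under sums and (-1, 0) under inverses.\<close>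

lemma int_forms_lin:
  assumes M: "compact_mfd M" and S: "S \<in> int_forms M P" and T: "T \<in> int_forms M P"
    and ab: "a \<in> \<int>" "b \<in> \<int>"
  shows "f_lin a S b T \<in> int_forms M P"
proof -
  obtain a' b' where ab': "a = of_int a'" "b = of_int b'"
    using ab by (auto elim!: Ints_cases)
  have "\<exists>z::int. has_form_integral V m cs u
      (form_wedge (form_pull (sac_mfd V) M f (f_lin a S b T)) \<eta>) (of_int z)"
    if "has_form_integral V m cs u (form_wedge (form_pull (sac_mfd V) M f S) \<eta>) (of_int y)"
      "has_form_integral V m cs u (form_wedge (form_pull (sac_mfd V) M f T) \<eta>) (of_int z)"
    for V m cs u f \<eta> and y z :: int
    using has_form_integral_lin[OF that, of a b] unfolding ab' form_pull_lin form_wedge_lin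
    by (intro exI[of _ "a' * y + b' * z"]) simp
  note int = this
  have "\<exists>z::int. has_form_integral V m cs u
      (form_wedge (form_pull (sac_mfd V) M f (f_lin a S b T)) (todd_form (sac_mfd V) (sac_bundle V))) (of_int z)"
    if V: "is_sac V \<and> P (mdim (sac_mfd V)) \<and> f \<in> smooth_maps (sac_mfd V) M \<and>
      partition_of_unity (sac_mfd V) m cs u" for V f m cs u
  proof -
    obtain y z :: int where
      "has_form_integral V m cs u
        (form_wedge (form_pull (sac_mfd V) M f S) (todd_form (sac_mfd V) (sac_bundle V))) (of_int y)"
      "has_form_integral V m cs u
        (form_wedge (form_pull (sac_mfd V) M f T) (todd_form (sac_mfd V) (sac_bundle V))) (of_int z)"
      using S T V unfolding int_forms_def by blast
    then show ?thesis
      by (rule int)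
  qed
  moreover have "f_lin a S b T \<in> closed_forms M P"
    using S T closed_forms_lin[OF M] unfolding int_forms_def by blast
  ultimately show ?thesis
    unfolding int_forms_def by blast
qed

lemma int_forms_zero:
  assumes "compact_mfd M"
  shows "f_zero \<in> int_forms M P"
proof -
  have "form_wedge (form_pull N M f f_zero) \<eta> = f_zero" for N :: "real mfd" and f \<eta>
    using form_pull_lin[of N M f 0 f_zero 0 f_zero] form_wedge_lin[of 0 f_zero 0 f_zero \<eta>] by simp
  then show ?thesis
    using closed_forms_zero[OF assms] has_form_integral_zero
    by (auto simp: int_forms_def intro!: exI[of _ 0])
qed

lemma comm_group_forms:
  assumes "compact_mfd M"
  shows "comm_group (form_group (Omega M P))"
proof (rule comm_groupI)
  fix \<omega> assume "\<omega> \<in> carrier (form_group (Omega M P))"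
  then show "\<exists>\<eta>\<in>carrier (form_group (Omega M P)). \<eta> \<otimes>\<^bsub>form_group (Omega M P)\<^esub> \<omega> = \<one>\<^bsub>form_group (Omega M P)\<^esub>"
    using Omega_lin[of \<omega> M P \<omega> "-1" 0]
    by (intro bexI[of _ "f_lin (-1) \<omega> 0 \<omega>"]) (auto simp: form_group_def f_add_def f_lin_def)
next
  fix \<omega> \<eta> assume "\<omega> \<in> carrier (form_group (Omega M P))" "\<eta> \<in> carrier (form_group (Omega M P))"
  then show "\<omega> \<otimes>\<^bsub>form_group (Omega M P)\<^esub> \<eta> \<in> carrier (form_group (Omega M P))"
    by (simp add: form_group_def f_add_eq_lin Omega_lin)
qed (use Omega_zero[OF assms] in \<open>auto simp: form_group_def f_add_def add_ac\<close>)

lemma inv_form_group: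
  assumes "compact_mfd M" and "\<omega> \<in> Omega M P"
  shows "inv\<^bsub>form_group (Omega M P)\<^esub> \<omega> = f_lin (-1) \<omega> 0 \<omega>"
proof -
  interpret comm_group "form_group (Omega M P)"
    by (rule comm_group_forms[OF assms(1)])
  show ?thesis
    using assms(2) Omega_lin[OF assms(2,2), of "-1" 0]
    by (intro inv_equality) (auto simp: form_group_def f_add_def f_lin_def)
qed

lemma int_forms_normal:
  assumes M: "compact_mfd M"
  shows "int_forms M P \<lhd> form_group (Omega M P)"
proof -
  interpret comm_group "form_group (Omega M P)"
    by (rule comm_group_forms[OF M])
  have sub: "int_forms M P \<subseteq> Omega M P"
    by (auto simp: int_forms_def closed_forms_def)
  have "subgroup (int_forms M P) (form_group (Omega M P))"
  proof (rule subgroupI)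
    show "int_forms M P \<subseteq> carrier (form_group (Omega M P))"
      using sub by (simp add: form_group_def)
    show "int_forms M P \<noteq> {}"
      using int_forms_zero[OF M] by blast
  next
    fix \<omega> assume "\<omega> \<in> int_forms M P"
    then show "inv\<^bsub>form_group (Omega M P)\<^esub> \<omega> \<in> int_forms M P"
      using sub inv_form_group[OF M] int_forms_lin[OF M, of \<omega> P \<omega> "-1" 0] by (auto simp: subset_iff)
  next
    fix \<omega> \<eta> assume "\<omega> \<in> int_forms M P" "\<eta> \<in> int_forms M P"
    then show "\<omega> \<otimes>\<^bsub>form_group (Omega M P)\<^esub> \<eta> \<in> int_forms M P"
      using int_forms_lin[OF M, of \<omega> P \<eta> 1 1] by (simp add: form_group_def f_add_eq_lin)
  qed
  then show ?thesis
    by (simp add: normal_iff_subgroup)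
qed


section \<open>The seminorms are finite\<close>

text \<open>The multilinear form under the absolute value in \<open>sup_norm\<close>: the degree k
  part of T at p on the vectors with coordinates \<open>v 0\<close>, ..., \<open>v (k - 1)\<close>.
  Such values, unlike components, do not depend on the chart.\<close>

definition tensor_eval :: "nat \<Rightarrow> nat \<Rightarrow> 'p field \<Rightarrow> 'p chart \<Rightarrow> 'p \<Rightarrow> (nat \<Rightarrow> nat \<Rightarrow> real) \<Rightarrow> real" where
  "tensor_eval n k T c p v = (\<Sum>I\<in>index_lists n k. T c I p * (\<Prod>l<k. v l (I ! l)))"

lemma tensor_eval_lin:
  "tensor_eval n k (f_lin a S b T) c p v = a * tensor_eval n k S c p v + b * tensor_eval n k T c p v"
  unfolding tensor_eval_def f_lin_def sum_distrib_left sum.distrib[symmetric]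
  by (intro sum.cong refl) (simp add: algebra_simps)

lemma finite_index_lists: "finite (index_lists n k)"
  using finite_lists_length_eq[of "{..<n}" k] by (simp add: index_lists_def conj_commute)

lemma index_lists_0: "index_lists n 0 = {[]}"
  by (auto simp: index_lists_def)

lemma sum_index_lists_Suc: "(\<Sum>I\<in>index_lists n (Suc k). F I) = (\<Sum>i<n. \<Sum>I\<in>index_lists n k. F (i # I))"
proof -
  have "bij_betw (\<lambda>(i, I). i # I) ({..<n} \<times> index_lists n k) (index_lists n (Suc k))"
    unfolding bij_betw_def by (auto simp: inj_on_def index_lists_def image_iff length_Suc_conv)
  from sum.reindex_bij_betw[OF this, of F]
  have "(\<Sum>I\<in>index_lists n (Suc k). F I) = (\<Sum>(i, I)\<in>{..<n} \<times> index_lists n k. F (i # I))"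
    by (simp add: case_prod_beta)
  then show ?thesis
    by (simp add: sum.cartesian_product)
qed

text \<open>Needed to change charts slot by slot: it turns one sum over all index lists into a
  separate sum for each slot.\<close>

lemma sum_index_lists_prod:
  fixes h :: "nat \<Rightarrow> nat \<Rightarrow> real"
  shows "(\<Sum>I\<in>index_lists n k. \<Prod>l<k. h l (I ! l)) = (\<Prod>l<k. \<Sum>i<n. h l i)"
proof (induction k arbitrary: h)
  case 0
  then show ?case by (simp add: index_lists_0)
next
  case (Suc k)
  have "(\<Sum>I\<in>index_lists n (Suc k). \<Prod>l<Suc k. h l (I ! l)) =
      (\<Sum>i<n. \<Sum>I\<in>index_lists n k. h 0 i * (\<Prod>l<k. h (Suc l) (I ! l)))"
    by (simp only: sum_index_lists_Suc prod.lessThan_Suc_shift nth_Cons_0 nth_Cons_Suc)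
  also have "\<dots> = (\<Sum>i<n. h 0 i) * (\<Prod>l<k. \<Sum>i<n. h (Suc l) i)"
    by (simp only: sum_distrib_left[symmetric] sum_distrib_right[symmetric] Suc.IH[of "\<lambda>l. h (Suc l)"])
  finally show ?case
    by (simp only: prod.lessThan_Suc_shift)
qed

text \<open>Presents the metric as a tensor evaluated on equal vectors, so that membership in its
  unit ball transforms by the same rule as the tensor field to be bounded.\<close>

lemma tensor_eval_2:
  "tensor_eval n 2 g c p (\<lambda>l. v) = (\<Sum>i<n. \<Sum>j<n. g c [i, j] p * v i * v j)"
  by (simp add: tensor_eval_def numeral_2_eq_2 sum_index_lists_Suc index_lists_0 mult.assoc)

text \<open>Interchanging the two sums over index lists shifts the Jacobian factors from the
  components to the vectors, where they form the coordinate change of a tangent vector.\<close>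

lemma tensor_eval_transform:
  assumes T: "cov_field M T" and c: "c \<in> atlas M" "c' \<in> atlas M" and p: "p \<in> fst c" "p \<in> fst c'"
  shows "tensor_eval (mdim M) k T c p v =
    tensor_eval (mdim M) k T c' p (\<lambda>l j. \<Sum>i<mdim M. jac c c' (\<lambda>q. q) p j i * v l i)"
proof -
  let ?L = "index_lists (mdim M) k" and ?j = "jac c c' (\<lambda>q. q) p"
  have "tensor_eval (mdim M) k T c p v =
      (\<Sum>I\<in>?L. \<Sum>J\<in>?L. T c' J p * (\<Prod>l<k. ?j (J ! l) (I ! l) * v l (I ! l)))"
    unfolding tensor_eval_def
  proof (intro sum.cong refl)
    fix I assume "I \<in> ?L"
    then have "length I = k" "T c I p = pull_comp (mdim M) c c' (\<lambda>q. q) T I p"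
      using cov_field_transform[OF T c p, of I] by (auto simp: index_lists_def)
    then show "T c I p * (\<Prod>l<k. v l (I ! l)) =
        (\<Sum>J\<in>?L. T c' J p * (\<Prod>l<k. ?j (J ! l) (I ! l) * v l (I ! l)))"
      by (simp add: pull_comp_def prod.distrib sum_distrib_left mult_ac)
  qed
  also have "\<dots> = (\<Sum>J\<in>?L. T c' J p * (\<Sum>I\<in>?L. \<Prod>l<k. ?j (J ! l) (I ! l) * v l (I ! l)))"
    by (subst sum.swap) (simp add: sum_distrib_left)
  also have "\<dots> = tensor_eval (mdim M) k T c' p (\<lambda>l j. \<Sum>i<mdim M. ?j j i * v l i)"
    unfolding tensor_eval_def
  proof (intro sum.cong refl)
    fix J
    show "T c' J p * (\<Sum>I\<in>?L. \<Prod>l<k. ?j (J ! l) (I ! l) * v l (I ! l)) =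
        T c' J p * (\<Prod>l<k. \<Sum>i<mdim M. ?j (J ! l) i * v l i)"
      using sum_index_lists_prod[of "\<lambda>l i. ?j (J ! l) i * v l i" k "mdim M"] by simp
  qed
  finally show ?thesis .
qed

text \<open>The minimum of the quadratic form on the unit sphere is attained, hence positive, and
  homogeneity carries the estimate to all v. For n = 0 the sphere is empty and any positive r will
  do.\<close>

lemma positive_definite_lower_bound:
  fixes G :: "nat \<Rightarrow> nat \<Rightarrow> real"
  assumes pos: "\<And>v. \<exists>i<n. v i \<noteq> 0 \<Longrightarrow> 0 < (\<Sum>i<n. \<Sum>j<n. G i j * v i * v j)"
  obtains r where "0 < r" and "\<And>v. r * (\<Sum>i<n. (v i)\<^sup>2) \<le> (\<Sum>i<n. \<Sum>j<n. G i j * v i * v j)"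
proof (cases "n = 0")
  case True
  then show ?thesis using that[of 1] by simp
next
  case False
  let ?q = "\<lambda>v. \<Sum>i<n. \<Sum>j<n. G i j * v i * v j"
  \<comment> \<open>Vectors are infinite sequences, and the sphere alone leaves the coordinates from
    n on free; intersected with a cube it is compact by Tychonoff.\<close>
  let ?K = "PiE UNIV (\<lambda>i. {-1..1}) \<inter> {v :: nat \<Rightarrow> real. (\<Sum>i<n. (v i)\<^sup>2) = 1}"
  have "compactin (product_topology (\<lambda>i. euclidean) UNIV) (PiE UNIV (\<lambda>i. {-1..1 :: real}))"
    by (subst compactin_PiE) auto
  then have "compact (PiE UNIV (\<lambda>i :: nat. {-1..1 :: real}))"
    by (simp add: euclidean_product_topology)
  moreover have "closed {v :: nat \<Rightarrow> real. (\<Sum>i<n. (v i)\<^sup>2) = 1}"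
    by (intro closed_Collect_eq continuous_intros continuous_on_product_coordinates)
  ultimately have K: "compact ?K"
    by (rule compact_Int_closed)
  have "(\<lambda>i. if i = 0 then 1 else 0) \<in> ?K"
    using False by (auto simp: if_distrib[of "\<lambda>x. x\<^sup>2"] cong: if_cong)
  then have ne: "?K \<noteq> {}"
    by blast
  have cont: "continuous_on ?K ?q"
    by (intro continuous_intros continuous_on_subset[OF continuous_on_product_coordinates]) auto
  from continuous_attains_inf[OF K ne cont]
  obtain w where w: "w \<in> ?K" "\<forall>v\<in>?K. ?q w \<le> ?q v"
    by (elim bexE)
  have "\<exists>i<n. w i \<noteq> 0"
  proof (rule ccontr)
    assume "\<not> ?thesis"
    then show False
      using w(1) by simp
  qed
  then have "0 < ?q w"
    by (rule pos)
  moreover have "?q w * (\<Sum>i<n. (v i)\<^sup>2) \<le> ?q v" for v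
  proof (cases "(\<Sum>i<n. (v i)\<^sup>2) = 0")
    case True
    then show ?thesis by (simp add: sum_nonneg_eq_0_iff)
  next
    case False
    define s where "s = (\<Sum>i<n. (v i)\<^sup>2)"
    have s: "0 < s"
      using False by (simp add: s_def sum_nonneg order_less_le)
    \<comment> \<open>The coordinates from n on, which do not enter the form, are set to 0 so that u
      lies in the cube.\<close>
    define u where "u = (\<lambda>i. if i < n then v i / sqrt s else 0)"
    have u2: "(\<Sum>i<n. (u i)\<^sup>2) = 1"
      using s by (simp add: u_def power_divide flip: sum_divide_distrib) (simp add: s_def)
    have "\<bar>u i\<bar> \<le> 1" for i
    proof (cases "i < n")
      case True
      then have "(u i)\<^sup>2 \<le> (\<Sum>i<n. (u i)\<^sup>2)"
        by (intro member_le_sum) auto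
      then show ?thesis
        using u2 by (simp add: abs_square_le_1)
    qed (simp add: u_def)
    then have "u \<in> ?K"
      using u2 by (auto simp: abs_le_iff minus_le_iff)
    with w(2) have "?q w \<le> ?q u"
      by (rule bspec)
    moreover have "?q u = ?q v / s"
      unfolding sum_divide_distrib
    proof (intro sum.cong refl)
      fix i j assume "i \<in> {..<n}" "j \<in> {..<n}"
      then show "G i j * u i * u j = G i j * v i * v j / s"
        using s by (simp add: u_def)
    qed
    ultimately have "?q w \<le> ?q v / s"
      by (rule ord_le_eq_trans)
    then have "?q w * s \<le> ?q v"
      by (rule iffD1[OF pos_le_divide_eq[OF s]])
    then show ?thesis
      unfolding s_def .
  qed
  ultimately show ?thesis
    by (rule that)
qed

text \<open>If the entries of H and G differ by less than e, the forms differ at v by at most n^2 e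
  |v|^2. With r the lower bound for G, e is chosen to make this at most r/2 times |v|^2, so that
  H(v) \<le> 1 forces |v|^2 \<le> 2/r. The bound R = 2/r + 1 avoids a square root, since t \<le> (t
  + 1)^2 for t > 0.\<close>

lemma nearby_metric_ball_bounded:
  fixes G :: "nat \<Rightarrow> nat \<Rightarrow> real"
  assumes "\<And>v. \<exists>i<n. v i \<noteq> 0 \<Longrightarrow> 0 < (\<Sum>i<n. \<Sum>j<n. G i j * v i * v j)"
  obtains e R where "0 < e" and "0 \<le> R" and
    "\<And>H v i. \<forall>i<n. \<forall>j<n. \<bar>H i j - G i j\<bar> < e \<Longrightarrow> (\<Sum>i<n. \<Sum>j<n. H i j * v i * v j) \<le> 1 \<Longrightarrow>
      i < n \<Longrightarrow> \<bar>v i\<bar> \<le> R"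
proof -
  obtain r where r: "0 < r" "\<And>v. r * (\<Sum>i<n. (v i)\<^sup>2) \<le> (\<Sum>i<n. \<Sum>j<n. G i j * v i * v j)"
    using positive_definite_lower_bound[of n G] assms by blast
  \<comment> \<open>The summand 1 keeps the denominator positive for n = 0.\<close>
  define e where "e = r / (2 * ((real n)\<^sup>2 + 1))"
  have n1: "0 < (real n)\<^sup>2 + 1"
    by (simp add: add_nonneg_pos)
  have e: "0 < e"
    using r(1) n1 by (simp add: e_def)
  have "(real n)\<^sup>2 * e \<le> ((real n)\<^sup>2 + 1) * e"
    using e by simp
  also have "\<dots> = r / 2"
    using n1 by (simp add: e_def field_simps)
  finally have n2e: "(real n)\<^sup>2 * e \<le> r / 2" .
  have "\<bar>v i\<bar> \<le> 2 / r + 1"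
    if H: "\<forall>i<n. \<forall>j<n. \<bar>H i j - G i j\<bar> < e" and q: "(\<Sum>i<n. \<Sum>j<n. H i j * v i * v j) \<le> 1" and i: "i < n"
    for H v i
  proof -
    define s where "s = (\<Sum>i<n. (v i)\<^sup>2)"
    have vs: "(v i)\<^sup>2 \<le> s" if "i < n" for i
      unfolding s_def using that by (intro member_le_sum) auto
    have s0: "0 \<le> s"
      by (simp add: s_def sum_nonneg)
    have vij: "\<bar>v i * v j\<bar> \<le> s" if "i < n" "j < n" for i j
      using vs[OF that(1)] vs[OF that(2)] sum_squares_bound[of "\<bar>v i\<bar>" "\<bar>v j\<bar>"]
      by (simp add: abs_mult)
    have "(\<Sum>i<n. \<Sum>j<n. G i j * v i * v j) - (\<Sum>i<n. \<Sum>j<n. H i j * v i * v j) =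
        (\<Sum>i<n. \<Sum>j<n. (G i j - H i j) * (v i * v j))"
      by (simp add: sum_subtractf algebra_simps)
    also have "\<dots> \<le> (\<Sum>i<n. \<Sum>j<n. e * s)"
    proof (intro sum_mono)
      fix i j assume ij: "i \<in> {..<n}" "j \<in> {..<n}"
      have "(G i j - H i j) * (v i * v j) \<le> \<bar>G i j - H i j\<bar> * \<bar>v i * v j\<bar>"
        by (metis abs_ge_self abs_mult)
      also have "\<dots> \<le> e * s"
      proof (rule mult_mono)
        show "\<bar>G i j - H i j\<bar> \<le> e"
          using H ij by (metis abs_minus_commute lessThan_iff less_imp_le)
      qed (use vij ij e in auto)
      finally show "(G i j - H i j) * (v i * v j) \<le> e * s" .
    qed
    also have "\<dots> = (real n)\<^sup>2 * e * s"
      by (simp add: power2_eq_square)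
    also have "\<dots> \<le> r / 2 * s"
      using n2e s0 by (rule mult_right_mono)
    finally have "r * s - 1 \<le> r / 2 * s"
      using r(2)[of v] q by (simp add: s_def)
    then have "s \<le> 2 / r"
      using r(1) by (simp add: field_simps)
    then have "(v i)\<^sup>2 \<le> 2 / r"
      using vs[OF i] by simp
    also have "\<dots> \<le> (2 / r + 1)\<^sup>2"
    proof -
      define t where "t = 2 / r"
      have "0 < t"
        using r(1) by (simp add: t_def)
      then have "t \<le> (t + 1)\<^sup>2"
        using zero_le_power2[of t] by (simp add: power2_sum)
      then show ?thesis
        by (simp add: t_def)
    qed
    finally have "\<bar>v i\<bar>\<^sup>2 \<le> (2 / r + 1)\<^sup>2"
      by simp
    then show ?thesis
      using r(1) by (intro power2_le_imp_le[of "\<bar>v i\<bar>"]) auto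
  qed
  then show ?thesis
    using that[of e "2 / r + 1"] e r(1) by force
qed

section \<open>The topology of the manifold and the bound by compactness\<close>

lemma openin_mfd_top:
  assumes "compact_mfd M"
  shows "openin (mfd_top M) W \<longleftrightarrow> W \<subseteq> pts M \<and>
    (\<forall>c\<in>atlas M. openin (corner_space (mdim M)) (snd c ` (W \<inter> fst c)))"
  unfolding mfd_top_def
proof (rule openin_topology_iff)
  have int: "snd c ` (V \<inter> W \<inter> fst c) = snd c ` (V \<inter> fst c) \<inter> snd c ` (W \<inter> fst c)"
    if "c \<in> atlas M" for c V W
  proof -
    have "inj_on (snd c) (fst c)"
      using assms that by (simp add: compact_mfd_def)
    then show ?thesis
      by (auto simp: inj_on_def)
  qed
  have un: "snd c ` (\<Union>\<K> \<inter> fst c) = (\<Union>W\<in>\<K>. snd c ` (W \<inter> fst c))" for c \<K>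
    by blast
  show "istopology (\<lambda>W. W \<subseteq> pts M \<and>
      (\<forall>c\<in>atlas M. openin (corner_space (mdim M)) (snd c ` (W \<inter> fst c))))"
    unfolding istopology_def by (auto simp: int un)
qed

text \<open>Seen in another chart, the set is the preimage of Q under the transition map. This map
  is continuous coordinatewise: the first \<open>mdim M\<close> coordinates are smooth by the atlas
  condition, the others are constantly 0.\<close>

lemma openin_mfd_top_chart:
  assumes M: "compact_mfd M" and c: "c \<in> atlas M" and Q: "openin (corner_space (mdim M)) Q"
  shows "openin (mfd_top M) {p \<in> fst c. snd c p \<in> Q}"
  unfolding openin_mfd_top[OF M]
proof (intro conjI ballI)
  show "{p \<in> fst c. snd c p \<in> Q} \<subseteq> pts M"
    using M c by (auto simp: compact_mfd_def)
  fix c' assume c': "c' \<in> atlas M"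
  let ?V = "snd c' ` (fst c' \<inter> fst c)" and ?\<phi> = "\<lambda>y. snd c (cinv c' y)"
  have V: "openin (corner_space (mdim M)) ?V"
    and sm: "\<And>j. j < mdim M \<Longrightarrow> smooth_on (mdim M) ?V (\<lambda>y. ?\<phi> y j)"
    and inj: "inj_on (snd c') (fst c')"
    using M c c' by (auto simp: compact_mfd_def)
  have corner: "?\<phi> y \<in> {x. (\<forall>i\<ge>mdim M. x i = 0) \<and> (\<forall>i<mdim M. 0 \<le> x i)}" if "y \<in> ?V" for y
  proof -
    have "?\<phi> y \<in> snd c ` fst c"
      using that inj by auto
    then show ?thesis
      using openin_chart_image[OF M c] by (auto simp: openin_corner_space_iff)
  qed
  have cont: "continuous_on ?V ?\<phi>"
  proof (rule continuous_on_coordinatewise_then_product)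
    fix j
    show "continuous_on ?V (\<lambda>y. ?\<phi> y j)"
    proof (cases "j < mdim M")
      case True
      then show ?thesis
        using continuous_on_smooth_on[OF V sm] by simp
    next
      case False
      then have "?\<phi> y j = 0" if "y \<in> ?V" for y
        using corner[OF that] by simp
      then show ?thesis
        by (subst continuous_on_cong[OF refl, of _ _ "\<lambda>y. 0"]) auto
    qed
  qed
  obtain Z Z' where Z: "open Z" "Q = Z \<inter> {x. (\<forall>i\<ge>mdim M. x i = 0) \<and> (\<forall>i<mdim M. 0 \<le> x i)}"
    and Z': "open Z'" "?V = Z' \<inter> {x. (\<forall>i\<ge>mdim M. x i = 0) \<and> (\<forall>i<mdim M. 0 \<le> x i)}"
    using Q V unfolding openin_corner_space_iff by blast
  obtain A where A: "open A" "A \<inter> ?V = ?\<phi> -` Z \<inter> ?V"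
    using cont Z(1) unfolding continuous_on_open_invariant by blast
  have "snd c' ` ({p \<in> fst c. snd c p \<in> Q} \<inter> fst c') = ?\<phi> -` Q \<inter> ?V"
    using inj by (auto simp: image_iff)
  also have "\<dots> = ?\<phi> -` Z \<inter> ?V"
    using corner Z(2) by blast
  also have "\<dots> = A \<inter> ?V"
    by (rule A(2)[symmetric])
  also have "\<dots> = A \<inter> Z' \<inter> {x. (\<forall>i\<ge>mdim M. x i = 0) \<and> (\<forall>i<mdim M. 0 \<le> x i)}"
    by (simp only: Z'(2) Int_assoc)
  finally show "openin (corner_space (mdim M)) (snd c' ` ({p \<in> fst c. snd c p \<in> Q} \<inter> fst c'))"
    unfolding openin_corner_space_iff using A(1) Z'(1) by blast
qed

lemma topspace_mfd_top:
  assumes "compact_mfd M"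
  shows "topspace (mfd_top M) = pts M"
proof -
  have "fst c \<subseteq> pts M" if "c \<in> atlas M" for c
    using assms that by (auto simp: compact_mfd_def)
  then have "pts M \<inter> fst c = fst c" if "c \<in> atlas M" for c
    using that by blast
  then have "openin (mfd_top M) (pts M)"
    by (simp add: openin_mfd_top[OF assms] openin_chart_image[OF assms])
  then show ?thesis
    by (metis assms openin_mfd_top openin_subset openin_topspace subset_antisym)
qed

lemma cov_field_component_nbhd:
  assumes M: "compact_mfd M" and T: "cov_field M T" and c: "c \<in> atlas M"
  shows "openin (mfd_top M) {p \<in> fst c. \<bar>T c I p - a\<bar> < e}"
proof -
  let ?V = "snd c ` fst c" and ?f = "\<lambda>x. T c I (cinv c x)"
  have V: "openin (corner_space (mdim M)) ?V"
    by (rule openin_chart_image[OF M c])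
  have "continuous_on ?V ?f"
    by (rule continuous_on_smooth_on[OF V cov_field_smooth[OF T c]])
  moreover have "open {y :: real. \<bar>y - a\<bar> < e}"
    by (intro open_Collect_less continuous_intros)
  ultimately obtain A where A: "open A" "A \<inter> ?V = ?f -` {y. \<bar>y - a\<bar> < e} \<inter> ?V"
    unfolding continuous_on_open_invariant by blast
  obtain Z where Z: "open Z" "?V = Z \<inter> {x. (\<forall>i\<ge>mdim M. x i = 0) \<and> (\<forall>i<mdim M. 0 \<le> x i)}"
    using V unfolding openin_corner_space_iff by blast
  have "A \<inter> ?V = (A \<inter> Z) \<inter> {x. (\<forall>i\<ge>mdim M. x i = 0) \<and> (\<forall>i<mdim M. 0 \<le> x i)}"
    by (simp only: Z(2) Int_assoc)
  then have "openin (corner_space (mdim M)) (A \<inter> ?V)"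
    unfolding openin_corner_space_iff using A(1) Z(1) by blast
  then have "openin (mfd_top M) {p \<in> fst c. snd c p \<in> A \<inter> ?V}"
    by (rule openin_mfd_top_chart[OF M c])
  moreover have "snd c p \<in> A \<inter> ?V \<longleftrightarrow> \<bar>T c I p - a\<bar> < e" if "p \<in> fst c" for p
  proof -
    have "inj_on (snd c) (fst c)"
      using M c by (simp add: compact_mfd_def)
    then show ?thesis
      using that by (simp add: A(2))
  qed
  ultimately show ?thesis
    by (metis (mono_tags, lifting) Collect_cong)
qed

lemma openin_Collect_finite_ball:
  assumes "openin X S" and "finite A" and "\<And>a. a \<in> A \<Longrightarrow> openin X {x \<in> S. P a x}"
  shows "openin X {x \<in> S. \<forall>a\<in>A. P a x}"
  using assms(2,3)
proof (induction A)
  case empty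
  then show ?case using assms(1) by simp
next
  case (insert a A)
  have "{x \<in> S. \<forall>b\<in>insert a A. P b x} = {x \<in> S. P a x} \<inter> {x \<in> S. \<forall>b\<in>A. P b x}"
    by blast
  then show ?case
    using insert.IH insert.prems openin_Int by (metis (no_types, lifting) insertCI)
qed

abbreviation metric_sq :: "'p mfd \<Rightarrow> 'p field \<Rightarrow> 'p chart \<Rightarrow> 'p \<Rightarrow> (nat \<Rightarrow> real) \<Rightarrow> real" where
  "metric_sq M g c p w \<equiv> (\<Sum>i<mdim M. \<Sum>j<mdim M. g c [i, j] p * w i * w j)"

text \<open>On \<open>W1\<close> the components of T differ from their values at q by less than 1,
  and on \<open>W2\<close> the metric is so close to its value at q that vectors of its unit ball
  have coordinates of size at most R. Each of the finitely many terms of \<open>tensor_eval\<close>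
  is then at most (|T(q)| + 1) R^k.\<close>

lemma tensor_eval_locally_bounded:
  assumes M: "compact_mfd M" and g: "riemannian_metric M g" and T: "cov_field M T"
    and c: "c \<in> atlas M" and q: "q \<in> fst c"
  obtains W B where "openin (mfd_top M) W" and "q \<in> W" and "W \<subseteq> fst c" and
    "\<And>p v. p \<in> W \<Longrightarrow> \<forall>l<k. metric_sq M g c p (v l) \<le> 1 \<Longrightarrow> \<bar>tensor_eval (mdim M) k T c p v\<bar> \<le> B"
proof -
  let ?n = "mdim M" and ?L = "index_lists (mdim M) k"
  have g': "cov_field M g"
    using g by (simp add: riemannian_metric_def tensor_field_def)
  have pos: "0 < (\<Sum>i<?n. \<Sum>j<?n. g c [i, j] q * v i * v j)" if "\<exists>i<?n. v i \<noteq> 0" for v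
    using g c q that unfolding riemannian_metric_def by blast
  obtain e R where e: "0 < e" and R: "0 \<le> R" and
    bd: "\<And>H v i. \<forall>i<?n. \<forall>j<?n. \<bar>H i j - g c [i, j] q\<bar> < e \<Longrightarrow>
      (\<Sum>i<?n. \<Sum>j<?n. H i j * v i * v j) \<le> 1 \<Longrightarrow> i < ?n \<Longrightarrow> \<bar>v i\<bar> \<le> R"
    by (rule nearby_metric_ball_bounded[of ?n "\<lambda>i j. g c [i, j] q", OF pos]) (assumption, rule that)
  define W1 where "W1 = {p \<in> fst c. \<forall>I\<in>?L. \<bar>T c I p - T c I q\<bar> < 1}"
  define W2 where "W2 = {p \<in> fst c. \<forall>ij\<in>{..<?n} \<times> {..<?n}. \<bar>g c [fst ij, snd ij] p - g c [fst ij, snd ij] q\<bar> < e}"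
  have "openin (mfd_top M) (fst c)"
    using openin_mfd_top_chart[OF M c openin_chart_image[OF M c]] by (simp add: Collect_mem_eq cong: conj_cong)
  then have "openin (mfd_top M) (W1 \<inter> W2)"
    unfolding W1_def W2_def
    using finite_index_lists cov_field_component_nbhd[OF M _ c] T g'
    by (intro openin_Int openin_Collect_finite_ball) auto
  moreover have "q \<in> W1 \<inter> W2" "W1 \<inter> W2 \<subseteq> fst c"
    using q e by (auto simp: W1_def W2_def)
  moreover have "\<bar>tensor_eval ?n k T c p v\<bar> \<le> (\<Sum>I\<in>?L. (\<bar>T c I q\<bar> + 1) * R ^ k)"
    if p: "p \<in> W1 \<inter> W2" and v: "\<forall>l<k. metric_sq M g c p (v l) \<le> 1" for p v
  proof -
    have vR: "\<bar>v l i\<bar> \<le> R" if "l < k" "i < ?n" for l i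
      using bd[of "\<lambda>i j. g c [i, j] p" "v l" i] p v that by (auto simp: W2_def)
    have "\<bar>T c I p * (\<Prod>l<k. v l (I ! l))\<bar> \<le> (\<bar>T c I q\<bar> + 1) * R ^ k" if I: "I \<in> ?L" for I
    proof -
      have "(\<Prod>l<k. \<bar>v l (I ! l)\<bar>) \<le> (\<Prod>l<k. R)"
      proof (intro prod_mono conjI)
        fix l assume "l \<in> {..<k}"
        then have "I ! l < ?n"
          using I nth_mem by (fastforce simp: index_lists_def)
        then show "\<bar>v l (I ! l)\<bar> \<le> R"
          using vR \<open>l \<in> {..<k}\<close> by simp
      qed simp
      moreover have "\<bar>T c I p - T c I q\<bar> < 1"
        using p I by (simp add: W1_def)
      ultimately show ?thesis
        by (simp add: abs_mult abs_prod) (intro mult_mono, auto simp: prod_nonneg)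
    qed
    then show ?thesis
      unfolding tensor_eval_def by (intro order_trans[OF sum_abs sum_mono])
  qed
  ultimately show ?thesis
    using that by blast
qed

text \<open>The bound is to hold in all charts at once, and the atlas may be infinite. Near q it is
  found in one chart c; a vector of the metric unit ball in another chart becomes one of the unit
  ball in c, and T has the same value there, so the bound passes on unchanged whatever the size of
  the Jacobian.\<close>

lemma tensor_eval_bounded:
  assumes M: "compact_mfd M" and g: "riemannian_metric M g" and T: "cov_field M T"
  obtains B where "\<And>c p v. c \<in> atlas M \<Longrightarrow> p \<in> fst c \<Longrightarrow> \<forall>l<k. metric_sq M g c p (v l) \<le> 1 \<Longrightarrow>
    \<bar>tensor_eval (mdim M) k T c p v\<bar> \<le> B"
proof -
  let ?n = "mdim M"
  have g': "cov_field M g"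
    using g by (simp add: riemannian_metric_def tensor_field_def)
  define bound where "bound = (\<lambda>W B. \<forall>c\<in>atlas M. \<forall>p\<in>W \<inter> fst c. \<forall>v.
    (\<forall>l<k. metric_sq M g c p (v l) \<le> 1) \<longrightarrow> \<bar>tensor_eval ?n k T c p v\<bar> \<le> B)"
  let ?\<U> = "{W. openin (mfd_top M) W \<and> (\<exists>B. bound W B)}"
  have "pts M \<subseteq> \<Union>?\<U>"
  proof
    fix q assume "q \<in> pts M"
    then obtain c where c: "c \<in> atlas M" "q \<in> fst c"
      using M unfolding compact_mfd_def by blast
    obtain W B where W: "openin (mfd_top M) W" "q \<in> W" "W \<subseteq> fst c" and
      B: "\<And>p v. p \<in> W \<Longrightarrow> \<forall>l<k. metric_sq M g c p (v l) \<le> 1 \<Longrightarrow> \<bar>tensor_eval ?n k T c p v\<bar> \<le> B"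
      using tensor_eval_locally_bounded[OF M g T c] by blast
    have "bound W B"
      unfolding bound_def
    proof (intro ballI allI impI)
      fix c' p v
      assume c': "c' \<in> atlas M" and p: "p \<in> W \<inter> fst c'" and v: "\<forall>l<k. metric_sq M g c' p (v l) \<le> 1"
      let ?v = "\<lambda>l j. \<Sum>i<?n. jac c' c (\<lambda>q. q) p j i * v l i"
      have p': "p \<in> fst c'" "p \<in> fst c"
        using p W(3) by auto
      have "metric_sq M g c p (?v l) = metric_sq M g c' p (v l)" for l
        using tensor_eval_transform[OF g' c' c(1) p', of 2 "\<lambda>_. v l"] unfolding tensor_eval_2 by simp
      then have "\<bar>tensor_eval ?n k T c p ?v\<bar> \<le> B"
        using B[of p ?v] p v by simp
      then show "\<bar>tensor_eval ?n k T c' p v\<bar> \<le> B"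
        using tensor_eval_transform[OF T c' c(1) p'] by simp
    qed
    then show "q \<in> \<Union>?\<U>"
      using W by blast
  qed
  moreover have "compact_space (mfd_top M)"
    using M by (simp add: compact_mfd_def)
  ultimately obtain \<F> where \<F>: "finite \<F>" "\<F> \<subseteq> ?\<U>" "pts M \<subseteq> \<Union>\<F>"
    unfolding compact_space_alt topspace_mfd_top[OF M]
    by (metis (mono_tags, lifting) mem_Collect_eq)
  then have "\<forall>W\<in>\<F>. \<exists>B. bound W B"
    by blast
  from bchoice[OF this] obtain B where B: "\<And>W. W \<in> \<F> \<Longrightarrow> bound W (B W)"
    by blast
  \<comment> \<open>The sum of the absolute values bounds all the finitely many \<open>B W\<close>,
    and makes sense for an empty family too.\<close>
  have "\<bar>tensor_eval ?n k T c p v\<bar> \<le> (\<Sum>W\<in>\<F>. \<bar>B W\<bar>)"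
    if "c \<in> atlas M" "p \<in> fst c" "\<forall>l<k. metric_sq M g c p (v l) \<le> 1" for c p v
  proof -
    have "p \<in> pts M"
      using M that by (auto simp: compact_mfd_def)
    then obtain W where W: "W \<in> \<F>" "p \<in> W"
      using \<F>(3) by blast
    then have "\<bar>tensor_eval ?n k T c p v\<bar> \<le> B W"
      using B that by (auto simp: bound_def)
    also have "\<dots> \<le> \<bar>B W\<bar>"
      by simp
    also have "\<dots> \<le> (\<Sum>W\<in>\<F>. \<bar>B W\<bar>)"
      using W \<F>(1) by (intro member_le_sum) auto
    finally show ?thesis .
  qed
  then show ?thesis
    using that by blast
qed

section \<open>Sup norms and the seminorms of forms\<close>

lemma sup_norm_eq:
  "sup_norm M g k T = Sup (insert 0 {\<bar>tensor_eval (mdim M) k T c p v\<bar> | c p v.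
     c \<in> atlas M \<and> p \<in> fst c \<and> (\<forall>l<k. metric_sq M g c p (v l) \<le> 1)})"
  by (simp add: sup_norm_def tensor_eval_def)

lemma
  assumes M: "compact_mfd M" and g: "riemannian_metric M g" and T: "cov_field M T"
  shows sup_norm_nonneg: "0 \<le> sup_norm M g k T"
    and tensor_eval_le_sup_norm: "c \<in> atlas M \<Longrightarrow> p \<in> fst c \<Longrightarrow> \<forall>l<k. metric_sq M g c p (v l) \<le> 1 \<Longrightarrow>
      \<bar>tensor_eval (mdim M) k T c p v\<bar> \<le> sup_norm M g k T"
proof -
  let ?S = "insert 0 {\<bar>tensor_eval (mdim M) k T c p v\<bar> | c p v.
     c \<in> atlas M \<and> p \<in> fst c \<and> (\<forall>l<k. metric_sq M g c p (v l) \<le> 1)}"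
  obtain B where B: "\<And>c p v. c \<in> atlas M \<Longrightarrow> p \<in> fst c \<Longrightarrow> \<forall>l<k. metric_sq M g c p (v l) \<le> 1 \<Longrightarrow>
    \<bar>tensor_eval (mdim M) k T c p v\<bar> \<le> B"
    using tensor_eval_bounded[OF M g T] by blast
  have bdd: "bdd_above ?S"
    \<comment> \<open>On the empty manifold B may be negative, while 0 is always in the set.\<close>
    by (rule bdd_aboveI[of _ "max 0 B"]) (auto dest: B simp: le_max_iff_disj)
  show "0 \<le> sup_norm M g k T"
    unfolding sup_norm_eq by (rule cSup_upper[OF _ bdd]) simp
  show "\<bar>tensor_eval (mdim M) k T c p v\<bar> \<le> sup_norm M g k T"
    if "c \<in> atlas M" "p \<in> fst c" "\<forall>l<k. metric_sq M g c p (v l) \<le> 1"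
    unfolding sup_norm_eq by (rule cSup_upper[OF _ bdd]) (use that in blast)
qed

lemma sup_norm_lin:
  assumes M: "compact_mfd M" and g: "riemannian_metric M g" and S: "cov_field M S" and T: "cov_field M T"
  shows "sup_norm M g k (f_lin a S b T) \<le> \<bar>a\<bar> * sup_norm M g k S + \<bar>b\<bar> * sup_norm M g k T"
  unfolding sup_norm_eq[of M g k "f_lin a S b T"]
proof (rule cSup_least)
  fix y assume "y \<in> insert 0 {\<bar>tensor_eval (mdim M) k (f_lin a S b T) c p v\<bar> | c p v.
     c \<in> atlas M \<and> p \<in> fst c \<and> (\<forall>l<k. metric_sq M g c p (v l) \<le> 1)}"
  then consider "y = 0" | c p v where "y = \<bar>tensor_eval (mdim M) k (f_lin a S b T) c p v\<bar>"
    "c \<in> atlas M" "p \<in> fst c" "\<forall>l<k. metric_sq M g c p (v l) \<le> 1"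
    by blast
  then show "y \<le> \<bar>a\<bar> * sup_norm M g k S + \<bar>b\<bar> * sup_norm M g k T"
  proof cases
    case 1
    then show ?thesis
      by (simp add: sup_norm_nonneg[OF M g] S T)
  next
    case 2
    have "y \<le> \<bar>a\<bar> * \<bar>tensor_eval (mdim M) k S c p v\<bar> + \<bar>b\<bar> * \<bar>tensor_eval (mdim M) k T c p v\<bar>"
      unfolding 2(1) tensor_eval_lin abs_mult[symmetric] by (rule abs_triangle_ineq)
    also have "\<dots> \<le> \<bar>a\<bar> * sup_norm M g k S + \<bar>b\<bar> * sup_norm M g k T"
      using 2 by (intro add_mono mult_left_mono tensor_eval_le_sup_norm[OF M g] S T) auto
    finally show ?thesis .
  qed
qed simp

context
  fixes M :: "'p mfd" and g D
  assumes M: "compact_mfd M" and g: "riemannian_metric M g" and D: "affine_connection M D"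
begin

lemma tensor_field_connection_pow: "tensor_field M k T \<Longrightarrow> tensor_field M (j + k) ((D ^^ j) T)"
proof (induction j)
  case (Suc j)
  then show ?case
    using D by (simp add: affine_connection_def)
qed simp

text \<open>A connection is linear on tensor fields of one degree only; the degree is therefore
  tracked along its powers, and for forms the argument is applied to each
  \<open>degree_part\<close>.\<close>

lemma connection_pow_lin:
  assumes "tensor_field M k S" and "tensor_field M k T"
  shows "(D ^^ j) (f_lin a S b T) = f_lin a ((D ^^ j) S) b ((D ^^ j) T)"
proof (induction j)
  case (Suc j)
  have "D (f_lin a ((D ^^ j) S) b ((D ^^ j) T)) = f_lin a (D ((D ^^ j) S)) b (D ((D ^^ j) T))"
    unfolding f_lin_def
    using D tensor_field_connection_pow[OF assms(1), of j] tensor_field_connection_pow[OF assms(2), of j]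
    unfolding affine_connection_def by blast
  then show ?case
    by (simp add: Suc)
qed simp

lemma tensor_field_degree_part:
  assumes "\<omega> \<in> Omega M P"
  shows "tensor_field M k (degree_part k \<omega>)"
  using assms cov_field_degree_part[OF _ M, of \<omega> k]
  by (auto simp: tensor_field_def Omega_def diff_form_def) (simp add: degree_part_def)

lemma cov_field_connection_pow_degree_part:
  assumes "\<omega> \<in> Omega M P"
  shows "cov_field M ((D ^^ j) (degree_part k \<omega>))"
  using tensor_field_connection_pow[OF tensor_field_degree_part[OF assms]] by (simp add: tensor_field_def)

lemma form_seminorm_nonneg:
  assumes "\<omega> \<in> Omega M P"
  shows "0 \<le> form_seminorm M g D k N \<omega>"
  unfolding form_seminorm_def
  by (intro sum_nonneg sup_norm_nonneg[OF M g cov_field_connection_pow_degree_part[OF assms]])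

lemma form_seminorm_lin:
  assumes "\<omega> \<in> Omega M P" and "\<eta> \<in> Omega M P"
  shows "form_seminorm M g D k N (f_lin a \<omega> b \<eta>) \<le>
    \<bar>a\<bar> * form_seminorm M g D k N \<omega> + \<bar>b\<bar> * form_seminorm M g D k N \<eta>"
  unfolding form_seminorm_def sum_distrib_left sum.distrib[symmetric] degree_part_lin
    connection_pow_lin[OF tensor_field_degree_part[OF assms(1)] tensor_field_degree_part[OF assms(2)]]
  by (intro sum_mono sup_norm_lin[OF M g] cov_field_connection_pow_degree_part[OF assms(1)]
      cov_field_connection_pow_degree_part[OF assms(2)])

end


section \<open>The Frechet topology\<close>

context
  fixes M :: "'p mfd" and g D
  assumes M: "compact_mfd M" and g: "riemannian_metric M g" and D: "affine_connection M D"
begin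

abbreviation (input) fsn :: "nat \<Rightarrow> nat \<Rightarrow> 'p field \<Rightarrow> real" where
  "fsn \<equiv> form_seminorm M g D"

lemma f_diff_in_Omega: "\<omega> \<in> Omega M P \<Longrightarrow> \<eta> \<in> Omega M P \<Longrightarrow> f_diff \<omega> \<eta> \<in> Omega M P"
  by (simp add: f_diff_eq_lin Omega_lin)

lemma form_seminorm_triangle:
  assumes "\<omega> \<in> Omega M P" and "\<eta> \<in> Omega M P"
  shows "fsn k N (f_add \<omega> \<eta>) \<le> fsn k N \<omega> + fsn k N \<eta>"
  using form_seminorm_lin[OF M g D assms, of k N 1 1] by (simp add: f_add_eq_lin)

lemma form_seminorm_minus:
  assumes "\<omega> \<in> Omega M P"
  shows "fsn k N (f_lin (-1) \<omega> 0 \<omega>) = fsn k N \<omega>"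
proof (rule antisym)
  let ?\<eta> = "f_lin (-1) \<omega> 0 \<omega>"
  have \<eta>: "?\<eta> \<in> Omega M P"
    by (rule Omega_lin[OF assms assms])
  show "fsn k N ?\<eta> \<le> fsn k N \<omega>"
    using form_seminorm_lin[OF M g D assms assms, of k N "-1" 0] by simp
  have "f_lin (-1) ?\<eta> 0 ?\<eta> = \<omega>"
    by (simp add: f_lin_def)
  then show "fsn k N \<omega> \<le> fsn k N ?\<eta>"
    using form_seminorm_lin[OF M g D \<eta> \<eta>, of k N "-1" 0] by simp
qed

lemma openin_frechet_ball:
  "\<omega> \<in> Omega M P \<Longrightarrow> 0 < e \<Longrightarrow> openin (frechet_top M g D P) {\<eta> \<in> Omega M P. fsn k N (f_diff \<eta> \<omega>) < e}"
  unfolding frechet_top_def by (rule topology_generated_by_Basis) blast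

lemma frechet_ball_center:
  assumes "\<omega> \<in> Omega M P" and "0 < e"
  shows "\<omega> \<in> {\<eta> \<in> Omega M P. fsn k N (f_diff \<eta> \<omega>) < e}"
proof -
  \<comment> \<open>As a combination with both coefficients 0, the zero form has seminorm at most
    0.\<close>
  have "f_diff \<omega> \<omega> = f_lin 0 \<omega> 0 \<omega>"
    by (simp add: f_diff_def)
  then show ?thesis
    using form_seminorm_lin[OF M g D assms(1,1), of k N 0 0] assms by simp
qed

lemma topspace_frechet: "topspace (frechet_top M g D P) = Omega M P"
proof
  show "topspace (frechet_top M g D P) \<subseteq> Omega M P"
    unfolding frechet_top_def topology_generated_by_topspace by blast
  show "Omega M P \<subseteq> topspace (frechet_top M g D P)"
  proof
    fix \<omega> assume \<omega>: "\<omega> \<in> Omega M P"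
    have one: "(0 :: real) < 1"
      by simp
    show "\<omega> \<in> topspace (frechet_top M g D P)"
      using openin_subset[OF openin_frechet_ball[OF \<omega> one, of 0 0]]
        frechet_ball_center[OF \<omega> one, of 0 0] by (rule subsetD)
  qed
qed

text \<open>Preimages of the generating balls suffice. Their centres are arbitrary forms and not
  just values of the map, so distances to every \<omega> have to be controlled.\<close>

lemma continuous_map_into_frechet:
  assumes "\<And>y. y \<in> topspace Y \<Longrightarrow> \<phi> y \<in> Omega M P"
    and "\<And>\<omega> k N e. \<omega> \<in> Omega M P \<Longrightarrow> 0 < e \<Longrightarrow> openin Y {y \<in> topspace Y. fsn k N (f_diff (\<phi> y) \<omega>) < e}"
  shows "continuous_map Y (frechet_top M g D P) \<phi>"
  unfolding frechet_top_def
proof (rule continuous_on_generated_topo)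
  fix U assume "U \<in> {{\<eta> \<in> Omega M P. fsn k N (f_diff \<eta> \<omega>) < e} | \<omega> k N e. \<omega> \<in> Omega M P \<and> 0 < e}"
  then obtain \<omega> k N e where U: "U = {\<eta> \<in> Omega M P. fsn k N (f_diff \<eta> \<omega>) < e}" "\<omega> \<in> Omega M P" "0 < e"
    by blast
  have "\<phi> -` U \<inter> topspace Y = {y \<in> topspace Y. fsn k N (f_diff (\<phi> y) \<omega>) < e}"
    using assms(1) by (auto simp: U(1))
  then show "openin Y (\<phi> -` U \<inter> topspace Y)"
    using assms(2)[OF U(2,3)] by simp
next
  have "\<phi> ` topspace Y \<subseteq> topspace (frechet_top M g D P)"
    using assms(1) by (auto simp: topspace_frechet)
  then show "\<phi> ` topspace Y \<subseteq>
      \<Union>{{\<eta> \<in> Omega M P. fsn k N (f_diff \<eta> \<omega>) < e} | \<omega> k N e. \<omega> \<in> Omega M P \<and> 0 < e}"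
    unfolding frechet_top_def topology_generated_by_topspace .
qed

text \<open>Both operations are tested on a ball around an arbitrary \<omega>. For sums, balls of
  the same seminorm serve as neighbourhoods of the summands, by the triangle inequality. Inversion
  preserves every seminorm, so the preimage of the ball around \<omega> is the ball around its
  negative.\<close>

lemma topological_group_frechet: "topological_group (form_group (Omega M P)) (frechet_top M g D P)"
proof -
  let ?X = "frechet_top M g D P" and ?G = "form_group (Omega M P)"
  note top = topspace_frechet[of P]
  have car: "carrier ?G = Omega M P" and mult: "\<And>\<omega> \<eta>. \<omega> \<otimes>\<^bsub>?G\<^esub> \<eta> = f_add \<omega> \<eta>"
    by (simp_all add: form_group_def)
  have add: "f_add \<omega> \<eta> \<in> Omega M P" if "\<omega> \<in> Omega M P" "\<eta> \<in> Omega M P" for \<omega> \<eta>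
    unfolding f_add_eq_lin using that by (rule Omega_lin)
  have "continuous_map (prod_topology ?X ?X) ?X (\<lambda>(\<omega>, \<eta>). \<omega> \<otimes>\<^bsub>?G\<^esub> \<eta>)"
  proof (rule continuous_map_into_frechet)
    fix \<omega> and k N :: nat and e :: real
    assume \<omega>: "\<omega> \<in> Omega M P" and e: "0 < e"
    let ?P = "{y \<in> topspace (prod_topology ?X ?X).
      fsn k N (f_diff ((\<lambda>(\<omega>, \<eta>). \<omega> \<otimes>\<^bsub>?G\<^esub> \<eta>) y) \<omega>) < e}"
    show "openin (prod_topology ?X ?X) ?P"
      unfolding openin_prod_topology_alt
    proof (intro allI impI)
      fix a b assume "(a, b) \<in> ?P"
      then have ab: "a \<in> Omega M P" "b \<in> Omega M P" and lt: "fsn k N (f_diff (f_add a b) \<omega>) < e"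
        by (auto simp: top mult)
      \<comment> \<open>Half of what is left below e is granted to each summand.\<close>
      define r where "r = (e - fsn k N (f_diff (f_add a b) \<omega>)) / 2"
      have r: "0 < r"
        using lt by (simp add: r_def)
      let ?B = "\<lambda>a. {\<eta> \<in> Omega M P. fsn k N (f_diff \<eta> a) < r}"
      have "(a', b') \<in> ?P" if a': "a' \<in> ?B a" and b': "b' \<in> ?B b" for a' b'
      proof -
        have *: "f_diff a' a \<in> Omega M P" "f_diff b' b \<in> Omega M P" "f_diff (f_add a b) \<omega> \<in> Omega M P"
          using ab a' b' \<omega> add by (auto intro: f_diff_in_Omega)
        have "f_diff (f_add a' b') \<omega> = f_add (f_add (f_diff a' a) (f_diff b' b)) (f_diff (f_add a b) \<omega>)"
          by (simp add: f_diff_def f_add_def algebra_simps)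
        then have "fsn k N (f_diff (f_add a' b') \<omega>) \<le>
            fsn k N (f_diff a' a) + fsn k N (f_diff b' b) + fsn k N (f_diff (f_add a b) \<omega>)"
          using form_seminorm_triangle[OF add[OF *(1,2)] *(3), of k N]
            form_seminorm_triangle[OF *(1,2), of k N] by simp
        also have "\<dots> < e"
          using a' b' by (auto simp: r_def field_simps)
        finally show ?thesis
          using a' b' by (simp add: top mult)
      qed
      then show "\<exists>U V. openin ?X U \<and> openin ?X V \<and> a \<in> U \<and> b \<in> V \<and> U \<times> V \<subseteq> ?P"
        by (intro exI[of _ "?B a"] exI[of _ "?B b"] conjI openin_frechet_ball frechet_ball_center ab r
            subrelI) (erule SigmaE2)
    qed
  qed (auto simp: top mult add)
  moreover have "continuous_map ?X ?X (\<lambda>\<omega>. inv\<^bsub>?G\<^esub> \<omega>)"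
  proof (rule continuous_map_into_frechet)
    fix \<omega> and k N :: nat and e :: real
    assume \<omega>: "\<omega> \<in> Omega M P" and e: "0 < e"
    let ?m = "\<lambda>\<omega>. f_lin (-1) \<omega> 0 \<omega>"
    have m: "?m \<eta> \<in> Omega M P" if "\<eta> \<in> Omega M P" for \<eta>
      using that by (intro Omega_lin)
    have "fsn k N (f_diff (inv\<^bsub>?G\<^esub> \<eta>) \<omega>) = fsn k N (f_diff \<eta> (?m \<omega>))" if \<eta>: "\<eta> \<in> Omega M P" for \<eta>
    proof -
      have "f_diff (inv\<^bsub>?G\<^esub> \<eta>) \<omega> = ?m (f_diff \<eta> (?m \<omega>))"
        by (simp add: inv_form_group[OF M \<eta>] f_diff_def f_lin_def)
      then show ?thesis
        using form_seminorm_minus[OF f_diff_in_Omega[OF \<eta> m[OF \<omega>]], of k N] by simp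
    qed
    then have "{y \<in> topspace ?X. fsn k N (f_diff (inv\<^bsub>?G\<^esub> y) \<omega>) < e} =
        {\<eta> \<in> Omega M P. fsn k N (f_diff \<eta> (?m \<omega>)) < e}"
      by (auto simp: top)
    then show "openin ?X {y \<in> topspace ?X. fsn k N (f_diff (inv\<^bsub>?G\<^esub> y) \<omega>) < e}"
      using openin_frechet_ball[OF m[OF \<omega>] e] by simp
  qed (auto simp: top inv_form_group[OF M] Omega_lin)
  ultimately show ?thesis
    using comm_group_forms[OF M, of P] by (simp add: topological_group_def top car comm_group_def)
qed

text \<open>Every \<omega> is joined to 0 by the line t \<mapsto> t \<omega>. It is continuous
  because in each seminorm the distance of t \<omega> to a fixed form is Lipschitz in t, the
  constant being the seminorm of \<omega>.\<close>

lemma connected_space_frechet: "connected_space (frechet_top M g D P)"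
proof -
  let ?X = "frechet_top M g D P"
  have path: "continuous_map euclideanreal ?X (\<lambda>t. f_lin t \<omega> 0 \<omega>)" if \<omega>: "\<omega> \<in> Omega M P" for \<omega>
  proof (rule continuous_map_into_frechet)
    fix t show "f_lin t \<omega> 0 \<omega> \<in> Omega M P"
      by (rule Omega_lin[OF \<omega> \<omega>])
  next
    fix \<eta> and k N :: nat and e :: real
    assume \<eta>: "\<eta> \<in> Omega M P"
    let ?h = "\<lambda>t. fsn k N (f_diff (f_lin t \<omega> 0 \<omega>) \<eta>)"
    have le: "?h t \<le> ?h s + fsn k N \<omega> * \<bar>t - s\<bar>" for s t
    proof -
      have "f_diff (f_lin t \<omega> 0 \<omega>) \<eta> = f_lin 1 (f_diff (f_lin s \<omega> 0 \<omega>) \<eta>) (t - s) \<omega>"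
        by (simp add: f_diff_def f_lin_def algebra_simps)
      then show ?thesis
        using form_seminorm_lin[OF M g D f_diff_in_Omega[OF Omega_lin[OF \<omega> \<omega>] \<eta>] \<omega>, of k N 1 s 0 "t - s"]
        by (simp add: mult.commute)
    qed
    have "(fsn k N \<omega>)-lipschitz_on UNIV ?h"
    proof (rule lipschitz_onI)
      fix s t
      show "dist (?h s) (?h t) \<le> fsn k N \<omega> * dist s t"
        using le[of s t] le[of t s] by (simp add: dist_real_def abs_le_iff abs_minus_commute)
    qed (rule form_seminorm_nonneg[OF M g D \<omega>])
    then have "continuous_on UNIV ?h"
      by (rule lipschitz_on_continuous_on)
    then show "openin euclideanreal {t \<in> topspace euclideanreal. ?h t < e}"
      by (simp add: open_Collect_less)
  qed
  have "connected_component_of ?X f_zero \<omega>" if \<omega>: "\<omega> \<in> Omega M P" for \<omega>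
  proof -
    have "connectedin ?X ((\<lambda>t. f_lin t \<omega> 0 \<omega>) ` UNIV)"
      using connectedin_continuous_map_image[OF path[OF \<omega>], of UNIV] by simp
    moreover have "f_zero = f_lin 0 \<omega> 0 \<omega>" "\<omega> = f_lin 1 \<omega> 0 \<omega>"
      by (simp_all add: f_lin_def)
    ultimately show ?thesis
      unfolding connected_component_of_def by blast
  qed
  then show ?thesis
    unfolding connected_space_iff_connected_component topspace_frechet
    by (meson connected_component_of_sym connected_component_of_trans)
qed

lemma topological_group_Omega_odd_mod_U:
  "topological_group (Omega_odd_mod_U M) (Omega_odd_mod_U_top M g D)"
proof -
  have "U_coset M = (\<lambda>\<omega>. int_forms M odd #>\<^bsub>form_group (Omega M odd)\<^esub> \<omega>)"
    by (simp add: fun_eq_iff U_coset_def)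
  then show ?thesis
    using topological_group_quotient[OF topological_group_frechet int_forms_normal[OF M]]
    by (simp add: Omega_odd_mod_U_def Omega_odd_mod_U_top_def)
qed

lemma connected_space_Omega_odd_mod_U: "connected_space (Omega_odd_mod_U_top M g D)"
  unfolding Omega_odd_mod_U_top_def
  by (rule connected_space_quotient_map_image[OF quotient_map_quotient_top connected_space_frechet])

end

theorem proposition3p11:
  fixes K :: "('p, 'k) dK" and M :: "'p mfd"
    and g :: "'p field" and D :: "'p field \<Rightarrow> 'p field"
  assumes "differential_K_functor K" and "compact_mfd M"
    and "riemannian_metric M g" and "affine_connection M D"
  shows "(\<exists>!T. strict_topology K M g D T) \<and>
    (\<forall>T. strict_topology K M g D T \<longrightarrow>
       connected_component_of_set T \<one>\<^bsub>dK_obj K M\<^esub> = dK_i K M ` carrier (Omega_odd_mod_U M))"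
proof -
  interpret discrete_extension "Omega_odd_mod_U M" "Omega_odd_mod_U_top M g D" "dK_obj K M" "K_group M"
    "dK_i K M" "dK_delta K M"
    using assms topological_group_Omega_odd_mod_U[OF assms(2-4)]
    by (simp add: discrete_extension_def differential_K_functor_def contravariant_functor_def)
  \<comment> \<open>With \<open>K_group M\<close> discrete, \<open>strict_topology\<close> is
    literally the notion studied in the locale.\<close>
  have strict: "strict_topology K M g D T \<longleftrightarrow> strict_group_topology T" for T
    by (simp add: strict_topology_def)
  show ?thesis
    unfolding strict
    using strict_extension strict_topology_unique
      identity_component[OF _ connected_space_Omega_odd_mod_U[OF assms(2-4)]] by blast
qed

end
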